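(* Let $1\le p<\infty$, let $L$ be a Banach lattice, $X$ a closed subspace of $L$ which is $p$-convex in $L$, and $Y$ a Banach space. Then: (i) for every finite rank operator $T\colon Y\to X$ of the form $T=\sum_j y_j^*\otimes x_j$ ($y_j^*\in Y^*$, $x_j\in X$), $\|T\|_m\le K^p(X,L)\,\pi_p(T^* )$; (ii) if $T\colon Y\to X$ is bounded with $T^*\in\Pi_p(X^*,Y^* )$, then $T$, regarded as an operator into $L^{**}$, is order bounded and $\|T\|_m\le K^p(X,L)\,\pi_p(T^* )$.
   Context: $X$ is $p$-convex in $L$ if there is $K\ge1$ with $\|(\sum_{j=1}^n|x_j|^p)^{1/p}\|\le K(\sum_{j=1}^n\|x_j\|^p)^{1/p}$ for all finite sets $x_1,\dots,x_n\in X$ (the expression $(\sum|x_j|^p)^{1/p}$ being defined by the Krivine functional calculus in $L$); $K^p(X,L)$ is the smallest such $K$. An operator $S$ from a Banach space $Y$ to a Banach lattice $M$ is order bounded if there is $z\in M$, $z\ge0$, with $|Sy|\le\|y\|z$ for all $y\in Y$; $\|S\|_m$ is the infimum of $\|z\|$ over such $z$. $\Pi_p$ denotes the $p$-summing operators with $p$-summing norm $\pi_p$. *)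

theory Defs
  imports "HOL-Analysis.Analysis"
begin

class banach_lattice = banach + lattice + ordered_real_vector +
  assumes lattice_norm_mono:
    "sup x (- x) \<le> sup y (- y) \<Longrightarrow> norm x \<le> norm y"

definition labs :: "'a::banach_lattice \<Rightarrow> 'a" where
  "labs x = sup x (- x)"

text \<open>H n: continuous positively homogeneous real functions on R^n; points of R^n are
represented as functions nat => real of which only the coordinates j < n matter.\<close>

definition Hn :: "nat \<Rightarrow> ((nat \<Rightarrow> real) \<Rightarrow> real) set" where
  "Hn n = {h. continuous_on UNIV h
              \<and> (\<forall>t s. (\<forall>j<n. t j = s j) \<longrightarrow> h t = h s)
              \<and> (\<forall>c\<ge>0. \<forall>t. h (\<lambda>j. c * t j) = c * h t)}"

definition krivine_hom ::
  "nat \<Rightarrow> (nat \<Rightarrow> 'a::banach_lattice) \<Rightarrow> (((nat \<Rightarrow> real) \<Rightarrow> real) \<Rightarrow> 'a) \<Rightarrow> bool" where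
  "krivine_hom n x \<tau> \<longleftrightarrow>
     (\<forall>h\<in>Hn n. \<forall>g\<in>Hn n. \<forall>a b. \<tau> (\<lambda>t. a * h t + b * g t) = a *\<^sub>R \<tau> h + b *\<^sub>R \<tau> g)
   \<and> (\<forall>h\<in>Hn n. \<forall>g\<in>Hn n. \<tau> (\<lambda>t. max (h t) (g t)) = sup (\<tau> h) (\<tau> g))
   \<and> (\<forall>j<n. \<tau> (\<lambda>t. t j) = x j)"

definition krivine_calc ::
  "nat \<Rightarrow> (nat \<Rightarrow> 'a::banach_lattice) \<Rightarrow> ((nat \<Rightarrow> real) \<Rightarrow> real) \<Rightarrow> 'a" where
  "krivine_calc n x h = (THE z. \<exists>\<tau>. krivine_hom n x \<tau> \<and> z = \<tau> h)"

definition krivine_psum :: "real \<Rightarrow> nat \<Rightarrow> (nat \<Rightarrow> 'a::banach_lattice) \<Rightarrow> 'a" where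
  "krivine_psum p n x = krivine_calc n x (\<lambda>t. (\<Sum>j<n. \<bar>t j\<bar> powr p) powr (1 / p))"

text \<open>The subspace X of L is given as a Banach space 'x together with a linear isometric
embedding J : 'x -> 'l (its range is then a closed subspace of L).\<close>

definition pconvex_const :: "real \<Rightarrow> ('x::banach \<Rightarrow> 'l::banach_lattice) \<Rightarrow> real \<Rightarrow> bool" where
  "pconvex_const p J K \<longleftrightarrow> 1 \<le> K \<and>
     (\<forall>n (xs :: nat \<Rightarrow> 'x).
        norm (krivine_psum p n (\<lambda>j. J (xs j))) \<le> K * (\<Sum>j<n. norm (xs j) powr p) powr (1 / p))"

definition pconvex :: "real \<Rightarrow> ('x::banach \<Rightarrow> 'l::banach_lattice) \<Rightarrow> bool" where
  "pconvex p J \<longleftrightarrow> (\<exists>K. pconvex_const p J K)"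

definition Kp :: "real \<Rightarrow> ('x::banach \<Rightarrow> 'l::banach_lattice) \<Rightarrow> real" where
  "Kp p J = Inf {K. pconvex_const p J K}"

definition psumming_const :: "real \<Rightarrow> ('e::real_normed_vector \<Rightarrow> 'f::real_normed_vector) \<Rightarrow> real \<Rightarrow> bool" where
  "psumming_const p S C \<longleftrightarrow> 0 \<le> C \<and>
     (\<forall>n (es :: nat \<Rightarrow> 'e).
        (\<Sum>i<n. norm (S (es i)) powr p) powr (1 / p)
          \<le> C * (SUP f \<in> {f :: 'e \<Rightarrow>\<^sub>L real. norm f \<le> 1}. (\<Sum>i<n. \<bar>blinfun_apply f (es i)\<bar> powr p) powr (1 / p)))"

definition psumming :: "real \<Rightarrow> ('e::real_normed_vector \<Rightarrow> 'f::real_normed_vector) \<Rightarrow> bool" where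
  "psumming p S \<longleftrightarrow> bounded_linear S \<and> (\<exists>C. psumming_const p S C)"

definition pi_p :: "real \<Rightarrow> ('e::real_normed_vector \<Rightarrow> 'f::real_normed_vector) \<Rightarrow> real" where
  "pi_p p S = Inf {C. psumming_const p S C}"

definition dual_op :: "('y::real_normed_vector \<Rightarrow>\<^sub>L 'x::real_normed_vector)
    \<Rightarrow> ('x \<Rightarrow>\<^sub>L real) \<Rightarrow> ('y \<Rightarrow>\<^sub>L real)" where
  "dual_op T = (\<lambda>\<phi>. \<phi> o\<^sub>L T)"

definition ordbdd_L_by :: "('x::banach \<Rightarrow> 'l::banach_lattice) \<Rightarrow> ('y::real_normed_vector \<Rightarrow> 'x) \<Rightarrow> 'l \<Rightarrow> bool" where
  "ordbdd_L_by J T z \<longleftrightarrow> 0 \<le> z \<and> (\<forall>y. labs (J (T y)) \<le> norm y *\<^sub>R z)"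

definition ordbdd_L :: "('x::banach \<Rightarrow> 'l::banach_lattice) \<Rightarrow> ('y::real_normed_vector \<Rightarrow> 'x) \<Rightarrow> bool" where
  "ordbdd_L J T \<longleftrightarrow> (\<exists>z. ordbdd_L_by J T z)"

definition mnorm_L :: "('x::banach \<Rightarrow> 'l::banach_lattice) \<Rightarrow> ('y::real_normed_vector \<Rightarrow> 'x) \<Rightarrow> real" where
  "mnorm_L J T = Inf {norm z | z. ordbdd_L_by J T z}"

definition pos_dual :: "('l::banach_lattice \<Rightarrow>\<^sub>L real) \<Rightarrow> bool" where
  "pos_dual \<phi> \<longleftrightarrow> (\<forall>x. 0 \<le> x \<longrightarrow> 0 \<le> \<phi> x)"

definition le_bidual :: "(('l::banach_lattice \<Rightarrow>\<^sub>L real) \<Rightarrow>\<^sub>L real)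
    \<Rightarrow> (('l \<Rightarrow>\<^sub>L real) \<Rightarrow>\<^sub>L real) \<Rightarrow> bool" where
  "le_bidual F G \<longleftrightarrow> (\<forall>\<phi>. pos_dual \<phi> \<longrightarrow> F \<phi> \<le> G \<phi>)"

text \<open>|F| \<le> G in the vector lattice L**: since |F| = sup F (-F), this means
F \<le> G and -F \<le> G.\<close>

definition abs_le_bidual :: "(('l::banach_lattice \<Rightarrow>\<^sub>L real) \<Rightarrow>\<^sub>L real)
    \<Rightarrow> (('l \<Rightarrow>\<^sub>L real) \<Rightarrow>\<^sub>L real) \<Rightarrow> bool" where
  "abs_le_bidual F G \<longleftrightarrow> le_bidual F G \<and> le_bidual (- F) G"

definition bidual_emb :: "'l::banach_lattice \<Rightarrow> (('l \<Rightarrow>\<^sub>L real) \<Rightarrow>\<^sub>L real)" where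
  "bidual_emb x = Blinfun (\<lambda>\<phi> :: 'l \<Rightarrow>\<^sub>L real. blinfun_apply \<phi> x)"

definition ordbdd_bidual_by :: "('x::banach \<Rightarrow> 'l::banach_lattice) \<Rightarrow> ('y::real_normed_vector \<Rightarrow> 'x)
    \<Rightarrow> (('l \<Rightarrow>\<^sub>L real) \<Rightarrow>\<^sub>L real) \<Rightarrow> bool" where
  "ordbdd_bidual_by J T z \<longleftrightarrow> le_bidual 0 z \<and>
     (\<forall>y. abs_le_bidual (bidual_emb (J (T y))) (norm y *\<^sub>R z))"

definition ordbdd_bidual :: "('x::banach \<Rightarrow> 'l::banach_lattice) \<Rightarrow> ('y::real_normed_vector \<Rightarrow> 'x) \<Rightarrow> bool" where
  "ordbdd_bidual J T \<longleftrightarrow> (\<exists>z. ordbdd_bidual_by J T z)"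

definition mnorm_bidual :: "('x::banach \<Rightarrow> 'l::banach_lattice) \<Rightarrow> ('y::real_normed_vector \<Rightarrow> 'x) \<Rightarrow> real" where
  "mnorm_bidual J T = Inf {norm z | z. ordbdd_bidual_by J T z}"

end

(*
By the Hahn-Banach theorem, both bounds follow from one inequality: if phi_1, ..., phi_m are
positive functionals on L and y_1, ..., y_m lie in the unit ball of Y, then
  sum_k phi_k(J T y_k) <= K C |sum_k phi_k|
for every p-convexity constant K and every p-summing constant C of T*. A finite form of Pietsch
domination gives u_i in the unit ball of X and weights t_i with sum 1 such that |T* J* phi_k| is
essentially at most C (sum_i t_i |phi_k(J u_i)|^p)^(1/p). Since phi_k is positive, this is at most
C phi_k(Z) with Z = (sum_i t_i |J u_i|^p)^(1/p), and p-convexity gives |Z| <= K.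

The functional calculus itself is obtained from the fact that lattice-linear expressions are
differences of maxima of linear ones. If max_A <= max_B on R^n, every a in A is approximable from
the convex hull of B, so the inequality persists in L. No representation theorem is needed.
*)
theory Submission
  imports Defs "HOL-Library.Function_Algebras" "HOL-Library.Lattice_Algebras"
begin

section \<open>The Hahn-Banach theorem for sublinear functionals\<close>

definition sublinear :: "('v::real_vector \<Rightarrow> real) \<Rightarrow> bool" where
  "sublinear q \<longleftrightarrow> (\<forall>x y. q (x + y) \<le> q x + q y) \<and> (\<forall>c\<ge>0. \<forall>x. q (c *\<^sub>R x) = c * q x)"

lemma sublinear_add: "sublinear q \<Longrightarrow> q (x + y) \<le> q x + q y"
  and sublinear_scale: "sublinear q \<Longrightarrow> 0 \<le> c \<Longrightarrow> q (c *\<^sub>R x) = c * q x"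
  by (auto simp: sublinear_def)

lemma sublinear_0: "sublinear q \<Longrightarrow> q 0 = 0"
  using sublinear_scale[of q 0 0] by simp

lemma sublinear_uminus: "sublinear q \<Longrightarrow> - q (- x) \<le> q x"
  using sublinear_add[of q x "- x"] sublinear_0[of q] by simp

lemma sublinearI:
  assumes add: "\<And>x y. q (x + y) \<le> q x + q y"
    and zero: "q 0 = 0"
    and scale: "\<And>c x. 0 < c \<Longrightarrow> q (c *\<^sub>R x) \<le> c * q x"
  shows "sublinear q"
  unfolding sublinear_def
proof (intro conjI allI impI add)
  fix c :: real and x
  assume "0 \<le> c"
  show "q (c *\<^sub>R x) = c * q x"
  proof (cases "c = 0")
    case False
    with \<open>0 \<le> c\<close> have "c > 0" by simp
    have "c * q x = c * q (inverse c *\<^sub>R c *\<^sub>R x)" using \<open>c > 0\<close> by simp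
    also have "\<dots> \<le> c * (inverse c * q (c *\<^sub>R x))"
      using scale[of "inverse c" "c *\<^sub>R x"] \<open>c > 0\<close> by (intro mult_left_mono) auto
    finally show ?thesis using scale[OF \<open>c > 0\<close>, of x] \<open>c > 0\<close> by (simp add: field_simps)
  qed (simp add: zero)
qed

definition minorant_cone :: "('v::real_vector \<Rightarrow> real) \<Rightarrow> ('v \<times> real) set \<Rightarrow> bool" where
  "minorant_cone q A \<longleftrightarrow> 0 \<in> A \<and> (\<forall>a\<in>A. \<forall>b\<in>A. a + b \<in> A) \<and> (\<forall>c>0. \<forall>a\<in>A. c *\<^sub>R a \<in> A)
     \<and> (\<forall>a\<in>A. snd a \<le> q (fst a))"

definition cone_reduct :: "('v::real_vector \<Rightarrow> real) \<Rightarrow> ('v \<times> real) set \<Rightarrow> 'v \<Rightarrow> real" where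
  "cone_reduct q A x = (INF a\<in>A. q (x + fst a) - snd a)"

context
  fixes q :: "'v::real_vector \<Rightarrow> real" and A
  assumes q: "sublinear q" and A: "minorant_cone q A"
begin

lemma minorant_coneD:
  "0 \<in> A" "a \<in> A \<Longrightarrow> b \<in> A \<Longrightarrow> a + b \<in> A" "0 < c \<Longrightarrow> a \<in> A \<Longrightarrow> c *\<^sub>R a \<in> A"
  "a \<in> A \<Longrightarrow> snd a \<le> q (fst a)"
  using A by (auto simp: minorant_cone_def)

lemma cone_reduct_lower: "a \<in> A \<Longrightarrow> - q (- x) \<le> q (x + fst a) - snd a"
  using sublinear_add[OF q, of "x + fst a" "- x"] minorant_coneD(4)[of a] by simp

lemma cone_reduct_le: "a \<in> A \<Longrightarrow> cone_reduct q A x \<le> q (x + fst a) - snd a"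
  unfolding cone_reduct_def
  by (rule cINF_lower) (auto intro!: bdd_belowI2[of _ "- q (- x)"] cone_reduct_lower)

lemma cone_reduct_ge: "(\<And>a. a \<in> A \<Longrightarrow> r \<le> q (x + fst a) - snd a) \<Longrightarrow> r \<le> cone_reduct q A x"
  unfolding cone_reduct_def using minorant_coneD(1) by (intro cINF_greatest) auto

lemma cone_reduct_le_self: "cone_reduct q A x \<le> q x"
  using cone_reduct_le[OF minorant_coneD(1)] by simp

lemma cone_reduct_uminus: "a \<in> A \<Longrightarrow> cone_reduct q A (- fst a) \<le> - snd a"
  using cone_reduct_le[of a "- fst a"] sublinear_0[OF q] by simp

lemma sublinear_cone_reduct: "sublinear (cone_reduct q A)"
proof (rule sublinearI)
  fix x y
  have *: "cone_reduct q A (x + y) \<le> (q (x + fst a) - snd a) + (q (y + fst b) - snd b)"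
    if "a \<in> A" "b \<in> A" for a b
    using cone_reduct_le[OF minorant_coneD(2)[OF that], of "x + y"]
      sublinear_add[OF q, of "x + fst a" "y + fst b"] by (simp add: algebra_simps)
  have "cone_reduct q A (x + y) - (q (y + fst b) - snd b) \<le> cone_reduct q A x" if "b \<in> A" for b
    using *[OF _ that] by (intro cone_reduct_ge) (simp add: algebra_simps)
  then have "cone_reduct q A (x + y) - cone_reduct q A x \<le> cone_reduct q A y"
    by (intro cone_reduct_ge) (simp add: algebra_simps)
  then show "cone_reduct q A (x + y) \<le> cone_reduct q A x + cone_reduct q A y" by simp
next
  have "0 \<le> cone_reduct q A 0"
    using cone_reduct_lower[of _ 0] sublinear_0[OF q] by (intro cone_reduct_ge) auto
  then show "cone_reduct q A 0 = 0"
    using cone_reduct_le_self[of 0] sublinear_0[OF q] by simp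
next
  fix c :: real and x
  assume c: "0 < c"
  have "inverse c * cone_reduct q A (c *\<^sub>R x) \<le> cone_reduct q A x"
  proof (rule cone_reduct_ge)
    fix a assume "a \<in> A"
    have "cone_reduct q A (c *\<^sub>R x) \<le> q (c *\<^sub>R (x + fst a)) - c * snd a"
      using cone_reduct_le[OF minorant_coneD(3)[OF c \<open>a \<in> A\<close>], of "c *\<^sub>R x"]
      by (simp add: scaleR_add_right)
    also have "\<dots> = c * (q (x + fst a) - snd a)"
      using sublinear_scale[OF q, of c "x + fst a"] c by (simp add: algebra_simps)
    finally show "inverse c * cone_reduct q A (c *\<^sub>R x) \<le> q (x + fst a) - snd a"
      using c by (simp add: field_simps)
  qed
  then show "cone_reduct q A (c *\<^sub>R x) \<le> c * cone_reduct q A x"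
    using c by (simp add: field_simps)
qed

end

lemma sublinear_chain_INF:
  assumes "C \<noteq> {}" and sub: "\<And>f. f \<in> C \<Longrightarrow> sublinear f" and le: "\<And>f. f \<in> C \<Longrightarrow> f \<le> q"
    and chain: "\<And>f g. f \<in> C \<Longrightarrow> g \<in> C \<Longrightarrow> f \<le> g \<or> g \<le> f"
  shows "sublinear (\<lambda>x. INF f\<in>C. f x)" and "\<And>f x. f \<in> C \<Longrightarrow> (INF f\<in>C. f x) \<le> f x"
proof -
  let ?I = "\<lambda>x. INF f\<in>C. f x"
  have lb: "- q (- x) \<le> f x" if "f \<in> C" for f x
    using sublinear_uminus[OF sub[OF that], of x] le[OF that] by (smt (verit) le_funD)
  show I_le: "?I x \<le> f x" if "f \<in> C" for f x
    using that by (intro cINF_lower bdd_belowI2[of _ "- q (- x)"]) (auto intro: lb)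
  have I_ge: "r \<le> ?I x" if "\<And>f. f \<in> C \<Longrightarrow> r \<le> f x" for r x
    using that \<open>C \<noteq> {}\<close> by (intro cINF_greatest) auto
  show "sublinear ?I"
  proof (rule sublinearI)
    fix x y
    have *: "?I (x + y) \<le> f x + g y" if "f \<in> C" "g \<in> C" for f g
      using chain[OF that]
    proof
      assume "f \<le> g"
      then show ?thesis
        using I_le[OF that(1), of "x + y"] sublinear_add[OF sub[OF that(1)], of x y]
        by (smt (verit) le_funD)
    next
      assume "g \<le> f"
      then show ?thesis
        using I_le[OF that(2), of "x + y"] sublinear_add[OF sub[OF that(2)], of x y]
        by (smt (verit) le_funD)
    qed
    have "?I (x + y) - g y \<le> ?I x" if "g \<in> C" for g
      using *[OF _ that] by (intro I_ge) (simp add: algebra_simps)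
    then have "?I (x + y) - ?I x \<le> ?I y" by (intro I_ge) (simp add: algebra_simps)
    then show "?I (x + y) \<le> ?I x + ?I y" by simp
  next
    have "?I 0 = (INF f\<in>C. 0)" by (intro INF_cong sublinear_0 sub refl)
    then show "?I 0 = 0" using \<open>C \<noteq> {}\<close> by simp
  next
    fix c :: real and x
    assume c: "0 < c"
    have "inverse c * ?I (c *\<^sub>R x) \<le> ?I x"
    proof (rule I_ge)
      fix f assume "f \<in> C"
      then show "inverse c * ?I (c *\<^sub>R x) \<le> f x"
        using I_le[OF \<open>f \<in> C\<close>, of "c *\<^sub>R x"] sublinear_scale[OF sub[OF \<open>f \<in> C\<close>], of c x] c
        by (simp add: field_simps)
    qed
    then show "?I (c *\<^sub>R x) \<le> c * ?I x" using c by (simp add: field_simps)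
  qed
qed

lemma minorant_cone_ray:
  assumes q: "sublinear q"
  shows "minorant_cone q ((\<lambda>t. (t *\<^sub>R a, t * q a)) ` {0..})" (is "minorant_cone q ?A")
  unfolding minorant_cone_def
proof (intro conjI ballI allI impI)
  show "0 \<in> ?A" by (auto simp: image_iff zero_prod_def intro!: bexI[of _ 0])
next
  fix u v assume "u \<in> ?A" "v \<in> ?A"
  then obtain s t where "s \<ge> 0" "t \<ge> 0" "u = (s *\<^sub>R a, s * q a)" "v = (t *\<^sub>R a, t * q a)"
    by auto
  then show "u + v \<in> ?A"
    by (auto simp: algebra_simps intro!: image_eqI[of _ _ "s + t"])
next
  fix c :: real and u assume "c > 0" "u \<in> ?A"
  then obtain s where "s \<ge> 0" "u = (s *\<^sub>R a, s * q a)" by auto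
  then show "c *\<^sub>R u \<in> ?A"
    using \<open>c > 0\<close> by (auto simp: algebra_simps intro!: image_eqI[of _ _ "c * s"])
next
  fix u assume "u \<in> ?A"
  then show "snd u \<le> q (fst u)" by (auto simp: sublinear_scale[OF q])
qed

theorem sublinear_dominates_linear:
  fixes q :: "'v::real_vector \<Rightarrow> real"
  assumes q: "sublinear q"
  shows "\<exists>f. linear f \<and> f \<le> q"
proof -
  define S where "S = {f. sublinear f \<and> f \<le> q}"
  have po: "partial_order_on S (relation_of (\<ge>) S)"
    by (auto simp: partial_order_on_def preorder_on_def relation_of_def refl_on_def
        intro!: transI antisymI)
  have "\<exists>u\<in>S. \<forall>a\<in>C. u \<le> a" if "C \<in> Chains (relation_of (\<ge>) S)" for C
  proof (cases "C = {}")
    case True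
    then show ?thesis using q by (auto simp: S_def)
  next
    case False
    have C: "\<And>f. f \<in> C \<Longrightarrow> sublinear f \<and> f \<le> q"
      "\<And>f g. f \<in> C \<Longrightarrow> g \<in> C \<Longrightarrow> f \<le> g \<or> g \<le> f"
      using that by (auto simp: Chains_def relation_of_def S_def)
    note I = sublinear_chain_INF[of C q, OF False]
    have "(\<lambda>x. INF f\<in>C. f x) \<in> S"
      unfolding S_def mem_Collect_eq
    proof (intro conjI le_funI)
      show "sublinear (\<lambda>x. INF f\<in>C. f x)" using C by (intro I(1)) auto
      obtain f where "f \<in> C" using False by auto
      fix x
      have "(INF f\<in>C. f x) \<le> f x" using C \<open>f \<in> C\<close> by (intro I(2)) auto
      also have "\<dots> \<le> q x" using C \<open>f \<in> C\<close> by (auto dest: le_funD)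
      finally show "(INF f\<in>C. f x) \<le> q x" .
    qed
    moreover have "(\<lambda>x. INF f\<in>C. f x) \<le> f" if "f \<in> C" for f
      using C that by (intro le_funI I(2)) (auto dest: le_funD)
    ultimately show ?thesis by blast
  qed
  from predicate_Zorn[OF po this] obtain m where m: "m \<in> S" and
    min: "\<And>f. f \<in> S \<Longrightarrow> f \<le> m \<Longrightarrow> f = m" by auto
  have sm: "sublinear m" using m by (simp add: S_def)
  have super: "m x + m a \<le> m (x + a)" for x a
  proof -
    define A where "A = (\<lambda>t. (t *\<^sub>R a, t * m a)) ` {0..}"
    have A: "minorant_cone m A" unfolding A_def by (rule minorant_cone_ray[OF sm])
    have le: "cone_reduct m A \<le> m" by (intro le_funI cone_reduct_le_self sm A)
    then have "cone_reduct m A \<in> S"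
      using sublinear_cone_reduct[OF sm A] m by (auto simp: S_def)
    with le min have "cone_reduct m A = m" by blast
    moreover have "(a, m a) \<in> A" by (auto simp: A_def image_iff intro!: bexI[of _ 1])
    ultimately show ?thesis using cone_reduct_le[OF sm A, of "(a, m a)" x] by simp
  qed
  have add: "m (x + y) = m x + m y" for x y
    using super[of x y] sublinear_add[OF sm, of x y] by simp
  have neg: "m (- x) = - m x" for x
    using add[of x "- x"] sublinear_0[OF sm] by simp
  have "linear m"
  proof (rule linearI)
    fix r :: real and x
    show "m (r *\<^sub>R x) = r *\<^sub>R m x"
    proof (cases "r \<ge> 0")
      case False
      then show ?thesis using neg[of "(- r) *\<^sub>R x"] sublinear_scale[OF sm, of "- r" x] by simp
    qed (simp add: sublinear_scale[OF sm])
  qed (rule add)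
  then show ?thesis using m by (auto simp: S_def)
qed

theorem hahn_banach_cone:
  fixes q :: "'v::real_vector \<Rightarrow> real"
  assumes q: "sublinear q" and A: "minorant_cone q A"
  obtains f where "linear f" "\<And>x. f x \<le> q x" "\<And>c r. (c, r) \<in> A \<Longrightarrow> r \<le> f c"
proof -
  obtain f where f: "linear f" "f \<le> cone_reduct q A"
    using sublinear_dominates_linear[OF sublinear_cone_reduct[OF q A]] by auto
  show ?thesis
  proof
    show "f x \<le> q x" for x
      using f(2) cone_reduct_le_self[OF q A, of x] by (smt (verit) le_funD)
    show "r \<le> f c" if "(c, r) \<in> A" for c r
      using f(2) cone_reduct_uminus[OF q A that] linear_neg[OF f(1), of c]
      by (smt (verit) le_funD fst_conv snd_conv)
  qed (fact f(1))
qed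

corollary hahn_banach_point:
  fixes q :: "'v::real_vector \<Rightarrow> real"
  assumes q: "sublinear q"
  obtains f where "linear f" "\<And>x. f x \<le> q x" "f a = q a"
proof -
  define A where "A = (\<lambda>t. (t *\<^sub>R a, t * q a)) ` {0..}"
  have A: "minorant_cone q A" unfolding A_def by (rule minorant_cone_ray[OF q])
  obtain f where f: "linear f" "\<And>x. f x \<le> q x" "\<And>c r. (c, r) \<in> A \<Longrightarrow> r \<le> f c"
    using hahn_banach_cone[OF q A] by metis
  have "(a, q a) \<in> A" by (auto simp: A_def image_iff intro!: bexI[of _ 1])
  then have "f a = q a" using f(2)[of a] f(3) by (simp add: antisym)
  with f that show thesis by blast
qed

section \<open>Finite-dimensional separation\<close>

instantiation "fun" :: (type, real_vector) real_vector
begin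

definition scaleR_fun :: "real \<Rightarrow> ('a \<Rightarrow> 'b) \<Rightarrow> 'a \<Rightarrow> 'b" where
  "scaleR_fun c f = (\<lambda>x. c *\<^sub>R f x)"

instance
  by standard (simp_all add: scaleR_fun_def fun_eq_iff algebra_simps)

end

lemma scaleR_fun_apply [simp]: "(c *\<^sub>R f) x = c *\<^sub>R f x"
  by (simp add: scaleR_fun_def)

lemma sum_fun_apply: "(\<Sum>i\<in>I. F i) x = (\<Sum>i\<in>I. F i x)"
  by (induction I rule: infinite_finite_induct) auto

lemma linear_functional_coords:
  fixes f :: "(nat \<Rightarrow> real) \<Rightarrow> real"
  assumes f: "linear f" and null: "\<And>t. (\<And>k. k < m \<Longrightarrow> t k = 0) \<Longrightarrow> f t \<le> 0"
  shows "f t = (\<Sum>k<m. f (\<lambda>j. if j = k then 1 else 0) * t k)"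
proof -
  let ?e = "\<lambda>k j. if j = k then 1 else 0 :: real"
  define v where "v = t - (\<Sum>k<m. t k *\<^sub>R ?e k)"
  have v: "v k = 0" if "k < m" for k
  proof -
    have "(\<Sum>i<m. t i * ?e i k) = (\<Sum>i<m. if i = k then t k else 0)"
      by (intro sum.cong) auto
    then show ?thesis using that by (simp add: v_def sum_fun_apply)
  qed
  have "f v \<le> 0" "f (- v) \<le> 0" using v by (auto intro!: null)
  then have "f v = 0" by (simp add: linear_neg[OF f])
  then show ?thesis
    by (simp add: v_def linear_diff[OF f] linear_sum[OF f] linear_cmul[OF f] mult.commute)
qed

lemma convex_approx_point:
  fixes D :: "(nat \<Rightarrow> real) set"
  assumes D: "convex D"
    and supp: "\<And>w s. (\<And>d. d \<in> D \<Longrightarrow> (\<Sum>k<m. w k * d k) \<le> s) \<Longrightarrow> (\<Sum>k<m. w k * a k) \<le> s"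
    and "0 < \<epsilon>"
  obtains d where "d \<in> D" "\<And>k. k < m \<Longrightarrow> \<bar>a k - d k\<bar> < \<epsilon>"
proof (rule ccontr)
  note obtain_d = that
  assume contra: "\<not> thesis"
  define q where "q = (\<lambda>v :: nat \<Rightarrow> real. \<Sum>k<m. \<bar>v k\<bar>)"
  have q: "sublinear q"
    unfolding sublinear_def q_def
    by (auto simp: abs_mult sum_distrib_left simp flip: sum.distrib intro!: sum_mono)
  have far: "\<epsilon> \<le> q (a - d)" if "d \<in> D" for d
  proof (rule ccontr)
    assume *: "\<not> \<epsilon> \<le> q (a - d)"
    have "\<bar>a k - d k\<bar> < \<epsilon>" if "k < m" for k
      using member_le_sum[of k "{..<m}" "\<lambda>k. \<bar>a k - d k\<bar>"] that * by (auto simp: q_def)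
    with contra obtain_d \<open>d \<in> D\<close> show False by blast
  qed
  define A where "A = {(t *\<^sub>R (a - d), t * \<epsilon>) | t d. 0 \<le> t \<and> d \<in> D}"
  have "D \<noteq> {}"
    using supp[of "\<lambda>_. 0" "-1"] by auto
  have A: "minorant_cone q A"
    unfolding minorant_cone_def
  proof (intro conjI ballI allI impI)
    obtain d where "d \<in> D" using \<open>D \<noteq> {}\<close> by auto
    then show "0 \<in> A" unfolding A_def zero_prod_def mem_Collect_eq
      by (intro exI[of _ "0::real"] exI[of _ d]) simp
  next
    fix u v assume "u \<in> A" "v \<in> A"
    then obtain s t c d where *: "s \<ge> 0" "t \<ge> 0" "c \<in> D" "d \<in> D"
      "u = (s *\<^sub>R (a - c), s * \<epsilon>)" "v = (t *\<^sub>R (a - d), t * \<epsilon>)"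
      by (auto simp: A_def)
    show "u + v \<in> A"
    proof (cases "s + t = 0")
      case True
      then have "s = 0" "t = 0" using * by auto
      then have "u + v = (0 *\<^sub>R (a - c), 0 * \<epsilon>)" using * by simp
      then show ?thesis using \<open>c \<in> D\<close> unfolding A_def by blast
    next
      case False
      define e where "e = (s / (s + t)) *\<^sub>R c + (t / (s + t)) *\<^sub>R d"
      have "e \<in> D"
        unfolding e_def using * False by (intro convexD[OF D]) (auto simp flip: add_divide_distrib)
      moreover have "(s + t) *\<^sub>R (a - e) = s *\<^sub>R (a - c) + t *\<^sub>R (a - d)"
        using False by (simp add: e_def scaleR_diff_right scaleR_add_right) (simp add: algebra_simps)
      then have "u + v = ((s + t) *\<^sub>R (a - e), (s + t) * \<epsilon>)" using * by (simp add: distrib_right)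
      moreover have "0 \<le> s + t" using * by simp
      ultimately show ?thesis unfolding A_def by blast
    qed
  next
    fix c :: real and u assume "c > 0" "u \<in> A"
    then obtain s d where *: "s \<ge> 0" "d \<in> D" "u = (s *\<^sub>R (a - d), s * \<epsilon>)" by (auto simp: A_def)
    then show "c *\<^sub>R u \<in> A"
      using \<open>c > 0\<close> unfolding A_def mem_Collect_eq by (intro exI[of _ "c * s"] exI[of _ d]) simp
  next
    fix u assume "u \<in> A"
    then obtain s d where *: "s \<ge> 0" "d \<in> D" "u = (s *\<^sub>R (a - d), s * \<epsilon>)" by (auto simp: A_def)
    then show "snd u \<le> q (fst u)"
      using far[of d] by (simp add: sublinear_scale[OF q] mult_left_mono del: scaleR_right_diff_distrib)
  qed
  obtain f where f: "linear f" "\<And>x. f x \<le> q x" "\<And>c r. (c, r) \<in> A \<Longrightarrow> r \<le> f c"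
    using hahn_banach_cone[OF q A] by metis
  define w where "w k = f (\<lambda>j. if j = k then 1 else 0)" for k
  have f_eq: "f t = (\<Sum>k<m. w k * t k)" for t
    unfolding w_def
  proof (rule linear_functional_coords[OF f(1)])
    fix t :: "nat \<Rightarrow> real" assume "\<And>k. k < m \<Longrightarrow> t k = 0"
    then have "q t = 0" by (simp add: q_def)
    then show "f t \<le> 0" using f(2)[of t] by simp
  qed
  have "(\<Sum>k<m. w k * d k) \<le> (\<Sum>k<m. w k * a k) - \<epsilon>" if "d \<in> D" for d
  proof -
    have "(a - d, \<epsilon>) \<in> A" using that by (auto simp: A_def intro!: exI[of _ "1::real"])
    from f(3)[OF this] show ?thesis
      by (simp add: linear_diff[OF f(1)]) (simp add: f_eq)
  qed
  from supp[OF this] \<open>0 < \<epsilon>\<close> show False by simp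
qed

section \<open>The finite-dimensional p-norm\<close>

definition pnorm :: "real \<Rightarrow> nat \<Rightarrow> (nat \<Rightarrow> real) \<Rightarrow> real" where
  "pnorm p n t = (\<Sum>j<n. \<bar>t j\<bar> powr p) powr (1 / p)"

lemma pnorm_nonneg: "0 \<le> pnorm p n t"
  by (simp add: pnorm_def)

lemma pnorm_cong: "(\<And>j. j < n \<Longrightarrow> s j = t j) \<Longrightarrow> pnorm p n s = pnorm p n t"
  by (simp add: pnorm_def)

context
  fixes p :: real
  assumes p: "1 \<le> p"
begin

lemma pnorm_powr: "pnorm p n t powr p = (\<Sum>j<n. \<bar>t j\<bar> powr p)"
  using p by (simp add: pnorm_def powr_powr sum_nonneg)

lemma pnorm_mono: "(\<And>j. j < n \<Longrightarrow> \<bar>s j\<bar> \<le> \<bar>t j\<bar>) \<Longrightarrow> pnorm p n s \<le> pnorm p n t"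
  unfolding pnorm_def using p by (intro powr_mono2 sum_mono sum_nonneg) auto

lemma pnorm_scale: "pnorm p n (\<lambda>j. c * t j) = \<bar>c\<bar> * pnorm p n t"
proof -
  have "(\<Sum>j<n. \<bar>c * t j\<bar> powr p) = \<bar>c\<bar> powr p * (\<Sum>j<n. \<bar>t j\<bar> powr p)"
    by (simp add: abs_mult powr_mult sum_distrib_left)
  then show ?thesis using p by (simp add: pnorm_def powr_mult powr_powr sum_nonneg)
qed

lemma pnorm_le_iff: "0 \<le> r \<Longrightarrow> pnorm p n t \<le> r \<longleftrightarrow> (\<Sum>j<n. \<bar>t j\<bar> powr p) \<le> r powr p"
proof
  assume "0 \<le> r" "pnorm p n t \<le> r"
  then show "(\<Sum>j<n. \<bar>t j\<bar> powr p) \<le> r powr p"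
    using powr_mono2[of p "pnorm p n t" r] p by (simp add: pnorm_powr pnorm_nonneg)
next
  assume "0 \<le> r" "(\<Sum>j<n. \<bar>t j\<bar> powr p) \<le> r powr p"
  then have "pnorm p n t \<le> (r powr p) powr (1 / p)"
    unfolding pnorm_def using p by (intro powr_mono2 sum_nonneg) auto
  then show "pnorm p n t \<le> r" using p \<open>0 \<le> r\<close> by (simp add: powr_powr)
qed

lemma pnorm_eq_0: "pnorm p n t = 0 \<Longrightarrow> j < n \<Longrightarrow> t j = 0"
  by (simp add: pnorm_def sum_nonneg_eq_0_iff)

lemma convex_on_powr: "convex_on {0..} (\<lambda>x::real. x powr p)"
proof (rule convex_onI)
  fix t x y :: real
  assume t: "0 < t" "t < 1" and xy: "x \<in> {0..}" "y \<in> {0..}"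
  have *: "(c * z) powr p \<le> c * z powr p" if "0 < c" "c < 1" for c z :: real
  proof -
    have "c powr p \<le> c powr 1" using that p by (intro powr_mono') auto
    then show ?thesis using that by (simp add: powr_mult mult_right_mono)
  qed
  show "((1 - t) *\<^sub>R x + t *\<^sub>R y) powr p \<le> (1 - t) * x powr p + t * y powr p"
  proof (cases "x = 0 \<or> y = 0")
    case True
    then show ?thesis using *[of t y] *[of "1 - t" x] t by auto
  next
    case False
    then show ?thesis
      using convex_onD[OF powr_convex[OF p], of t x y] t xy by auto
  qed
qed simp

lemma pnorm_triangle: "pnorm p n (\<lambda>j. s j + t j) \<le> pnorm p n s + pnorm p n t"
proof -
  define A B where "A = pnorm p n s" and "B = pnorm p n t"
  have nn: "A \<ge> 0" "B \<ge> 0" by (auto simp: A_def B_def pnorm_nonneg)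
  consider "A = 0" | "B = 0" | "A > 0" "B > 0" using nn by linarith
  then show ?thesis
  proof cases
    case 1
    then have "pnorm p n (\<lambda>j. s j + t j) = pnorm p n t"
      by (intro pnorm_cong) (simp add: A_def pnorm_eq_0)
    then show ?thesis by (simp add: pnorm_nonneg)
  next
    case 2
    then have "pnorm p n (\<lambda>j. s j + t j) = pnorm p n s"
      by (intro pnorm_cong) (simp add: B_def pnorm_eq_0)
    then show ?thesis by (simp add: pnorm_nonneg)
  next
    case 3
    have powA: "(\<Sum>j<n. \<bar>s j\<bar> powr p) = A powr p" and powB: "(\<Sum>j<n. \<bar>t j\<bar> powr p) = B powr p"
      by (simp_all add: A_def B_def pnorm_powr)
    have "\<bar>s j + t j\<bar> powr p
        \<le> (A + B) powr p * (A / (A + B) * (\<bar>s j\<bar> / A) powr p + B / (A + B) * (\<bar>t j\<bar> / B) powr p)" for j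
    proof -
      have "\<bar>s j + t j\<bar> powr p \<le> ((A + B) * (A / (A + B) * (\<bar>s j\<bar> / A) + B / (A + B) * (\<bar>t j\<bar> / B))) powr p"
      proof (intro powr_mono2)
        have "(A + B) * (A / (A + B) * (\<bar>s j\<bar> / A) + B / (A + B) * (\<bar>t j\<bar> / B)) = \<bar>s j\<bar> + \<bar>t j\<bar>"
          using 3 by (simp add: distrib_left)
        then show "\<bar>s j + t j\<bar> \<le> (A + B) * (A / (A + B) * (\<bar>s j\<bar> / A) + B / (A + B) * (\<bar>t j\<bar> / B))"
          by simp
      qed (use p in auto)
      also have "\<dots> = (A + B) powr p * (A / (A + B) * (\<bar>s j\<bar> / A) + B / (A + B) * (\<bar>t j\<bar> / B)) powr p"
        using 3 by (intro powr_mult)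
      also have "\<dots> \<le> (A + B) powr p * (A / (A + B) * (\<bar>s j\<bar> / A) powr p + B / (A + B) * (\<bar>t j\<bar> / B) powr p)"
      proof (intro mult_left_mono)
        have "A / (A + B) + B / (A + B) = 1" using 3 by (simp flip: add_divide_distrib)
        then show "(A / (A + B) * (\<bar>s j\<bar> / A) + B / (A + B) * (\<bar>t j\<bar> / B)) powr p
            \<le> A / (A + B) * (\<bar>s j\<bar> / A) powr p + B / (A + B) * (\<bar>t j\<bar> / B) powr p"
          using convex_on_powr 3 unfolding convex_on_def by (auto simp del: times_divide_eq_left times_divide_eq_right nonzero_mult_div_cancel_left)
      qed simp
      finally show ?thesis .
    qed
    then have "(\<Sum>j<n. \<bar>s j + t j\<bar> powr p)
        \<le> (\<Sum>j<n. (A + B) powr p * (A / (A + B) * (\<bar>s j\<bar> / A) powr p + B / (A + B) * (\<bar>t j\<bar> / B) powr p))"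
      by (intro sum_mono)
    also have "\<dots> = (A + B) powr p * (A / (A + B) * ((\<Sum>j<n. \<bar>s j\<bar> powr p) / A powr p)
        + B / (A + B) * ((\<Sum>j<n. \<bar>t j\<bar> powr p) / B powr p))"
      using 3 by (simp add: powr_divide sum.distrib flip: sum_distrib_left sum_divide_distrib)
    also have "\<dots> = (A + B) powr p"
      using 3 by (simp add: powA powB flip: add_divide_distrib)
    finally show ?thesis
      using nn by (simp add: pnorm_le_iff flip: A_def B_def)
  qed
qed

lemma sublinear_pnorm: "sublinear (pnorm p n)"
  unfolding sublinear_def plus_fun_def scaleR_fun_def
  by (intro conjI allI impI pnorm_triangle) (simp add: pnorm_scale)

lemma pnorm_sum: "pnorm p n (\<lambda>j. \<Sum>i\<in>I. F i j) \<le> (\<Sum>i\<in>I. pnorm p n (F i))"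
proof (induction I rule: infinite_finite_induct)
  case (insert i I)
  then show ?case using pnorm_triangle[of n "F i" "\<lambda>j. \<Sum>i\<in>I. F i j"] by simp
qed (use p in \<open>simp_all add: pnorm_def\<close>)

lemma pnorm_norming:
  obtains a where "\<And>t. (\<Sum>j<n. a j * t j) \<le> pnorm p n t" "(\<Sum>j<n. a j * v j) = pnorm p n v"
proof -
  obtain f where f: "linear f" "\<And>t. f t \<le> pnorm p n t" "f v = pnorm p n v"
    using hahn_banach_point[OF sublinear_pnorm] by metis
  have eq: "f t = (\<Sum>k<n. f (\<lambda>j. if j = k then 1 else 0) * t k)" for t
  proof (rule linear_functional_coords[OF f(1)])
    fix t :: "nat \<Rightarrow> real" assume "\<And>k. k < n \<Longrightarrow> t k = 0"
    then have "pnorm p n t = pnorm p n (\<lambda>_. 0)" by (intro pnorm_cong) auto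
    then show "f t \<le> 0" using f(2)[of t] pnorm_scale[of n 0 "\<lambda>_. 0"] by simp
  qed
  show thesis
    by (rule that[of "\<lambda>k. f (\<lambda>j. if j = k then 1 else 0)"]) (simp_all add: f(2,3) flip: eq)
qed

lemma powr_inverse_add_le:
  fixes x y :: real
  assumes "0 \<le> x" "0 \<le> y"
  shows "(x + y) powr (1 / p) \<le> x powr (1 / p) + y powr (1 / p)"
proof -
  let ?s = "\<lambda>j::nat. if j = 0 then x powr (1 / p) else 0"
  let ?t = "\<lambda>j::nat. if j = 1 then y powr (1 / p) else 0"
  have "pnorm p 2 (\<lambda>j. ?s j + ?t j) \<le> pnorm p 2 ?s + pnorm p 2 ?t"
    by (rule pnorm_triangle)
  then show ?thesis
    using p assms by (simp add: pnorm_def eval_nat_numeral powr_powr)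
qed

end

section \<open>Banach lattices\<close>

instance banach_lattice < lattice_ab_group_add ..

lemma labs_nonneg: "0 \<le> labs (x::'a::banach_lattice)"
proof -
  have "x + - x \<le> labs x + labs x"
    by (intro add_mono) (simp_all add: labs_def)
  then show ?thesis by simp
qed

lemma labs_of_nonneg: "0 \<le> (x::'a::banach_lattice) \<Longrightarrow> labs x = x"
  unfolding labs_def by (intro sup_absorb1) (meson neg_le_0_iff_le order_trans)

lemma le_labs: "x \<le> labs (x::'a::banach_lattice)" and minus_le_labs: "- x \<le> labs x"
  by (simp_all add: labs_def)

lemma labs_leI: "x \<le> y \<Longrightarrow> - x \<le> y \<Longrightarrow> labs (x::'a::banach_lattice) \<le> y"
  by (simp add: labs_def)

lemma norm_le_of_abs_le:
  fixes x y :: "'a::banach_lattice"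
  assumes "x \<le> y" "- x \<le> y"
  shows "norm x \<le> norm y"
proof -
  have "labs x \<le> y" using assms by (rule labs_leI)
  also have "y \<le> labs y" by (rule le_labs)
  finally show ?thesis unfolding labs_def by (rule lattice_norm_mono)
qed

lemma norm_mono_nonneg: "0 \<le> x \<Longrightarrow> x \<le> y \<Longrightarrow> norm x \<le> norm (y::'a::banach_lattice)"
  by (rule norm_le_of_abs_le) (meson neg_le_0_iff_le order_trans)+

lemma norm_labs [simp]: "norm (labs x) = norm (x::'a::banach_lattice)"
proof (rule antisym)
  have "labs (labs x) = labs x" by (rule labs_of_nonneg[OF labs_nonneg])
  then show "norm (labs x) \<le> norm x"
    by (intro lattice_norm_mono) (simp add: labs_def)
qed (intro norm_le_of_abs_le le_labs minus_le_labs)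

lemma scaleR_sup:
  fixes x y :: "'a::banach_lattice"
  assumes "0 \<le> c"
  shows "c *\<^sub>R sup x y = sup (c *\<^sub>R x) (c *\<^sub>R y)"
proof (cases "c = 0")
  case False
  with assms have c: "c > 0" by simp
  show ?thesis
  proof (rule antisym)
    have "inverse c *\<^sub>R z \<le> inverse c *\<^sub>R sup (c *\<^sub>R x) (c *\<^sub>R y)" if "z \<in> {c *\<^sub>R x, c *\<^sub>R y}" for z
      using that c by (intro scaleR_left_mono) auto
    then have "sup x y \<le> inverse c *\<^sub>R sup (c *\<^sub>R x) (c *\<^sub>R y)"
      using c by force
    from scaleR_left_mono[OF this assms] show "c *\<^sub>R sup x y \<le> sup (c *\<^sub>R x) (c *\<^sub>R y)"
      using c by simp
  qed (use assms in \<open>simp add: scaleR_left_mono\<close>)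
qed simp

lemma scaleR_le_labs: "c *\<^sub>R x \<le> \<bar>c\<bar> *\<^sub>R labs (x::'a::banach_lattice)"
proof (cases "c \<ge> 0")
  case True
  then show ?thesis by (simp add: scaleR_left_mono le_labs)
next
  case False
  then have "(- c) *\<^sub>R (- x) \<le> (- c) *\<^sub>R labs x" by (intro scaleR_left_mono minus_le_labs) auto
  with False show ?thesis by simp
qed

lemma archimedean_le:
  fixes x y e :: "'a::banach_lattice"
  assumes "\<And>\<epsilon>. 0 < \<epsilon> \<Longrightarrow> x \<le> y + \<epsilon> *\<^sub>R e"
  shows "x \<le> y"
proof -
  define u where "u = sup (x - y) 0"
  have "norm u \<le> \<delta>" if "\<delta> > 0" for \<delta>
  proof -
    define \<epsilon> where "\<epsilon> = \<delta> / (norm e + 1)"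
    have "\<epsilon> > 0" using \<open>\<delta> > 0\<close> by (simp add: \<epsilon>_def add_nonneg_pos)
    have "x - y \<le> \<epsilon> *\<^sub>R e" using assms[OF \<open>\<epsilon> > 0\<close>] by (simp add: algebra_simps)
    also have "\<dots> \<le> \<epsilon> *\<^sub>R labs e" using \<open>\<epsilon> > 0\<close> by (simp add: scaleR_left_mono le_labs)
    finally have "u \<le> \<epsilon> *\<^sub>R labs e"
      unfolding u_def using \<open>\<epsilon> > 0\<close> by (simp add: labs_nonneg scaleR_nonneg_nonneg)
    then have "norm u \<le> norm (\<epsilon> *\<^sub>R labs e)"
      by (intro norm_mono_nonneg) (simp_all add: u_def)
    also have "\<dots> = \<delta> * (norm e / (norm e + 1))" using \<open>\<delta> > 0\<close> by (simp add: \<epsilon>_def)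
    also have "\<dots> \<le> \<delta> * 1"
      using \<open>\<delta> > 0\<close> by (intro mult_left_mono) (auto simp: divide_le_eq add_nonneg_pos)
    finally show ?thesis by simp
  qed
  then have "norm u \<le> 0" using field_le_epsilon[of "norm u" 0] by simp
  then have "sup (x - y) 0 = 0" by (simp add: u_def)
  then have "x - y \<le> 0" by (metis sup.cobounded1)
  then show ?thesis by simp
qed

lemma norm_sup_diff_le:
  fixes a b c d :: "'a::banach_lattice"
  shows "norm (sup a b - sup c d) \<le> norm (a - c) + norm (b - d)"
proof -
  let ?r = "labs (a - c) + labs (b - d)"
  have r: "labs (a - c) \<le> ?r" "labs (b - d) \<le> ?r" by (simp_all add: labs_nonneg)
  have "a \<le> sup c d + ?r"
    using add_mono[OF sup_ge1[of c d] order.trans[OF le_labs r(1)]] by simp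
  moreover have "b \<le> sup c d + ?r"
    using add_mono[OF sup_ge2[of d c] order.trans[OF le_labs r(2)]] by simp
  moreover have "c \<le> sup a b + ?r"
    using add_mono[OF sup_ge1[of a b] order.trans[OF minus_le_labs r(1)]] by simp
  moreover have "d \<le> sup a b + ?r"
    using add_mono[OF sup_ge2[of b a] order.trans[OF minus_le_labs r(2)]] by simp
  ultimately have "sup a b \<le> ?r + sup c d" "sup c d \<le> ?r + sup a b"
    by (simp_all add: add.commute)
  then have "norm (sup a b - sup c d) \<le> norm ?r"
    by (intro norm_le_of_abs_le) (simp_all only: minus_diff_eq diff_le_eq)
  also have "\<dots> \<le> norm (a - c) + norm (b - d)"
    using norm_triangle_ineq[of "labs (a - c)" "labs (b - d)"] by simp
  finally show ?thesis .
qed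

lemma tendsto_sup_banach_lattice:
  fixes f g :: "'b \<Rightarrow> 'a::banach_lattice"
  assumes "(f \<longlongrightarrow> a) F" "(g \<longlongrightarrow> b) F"
  shows "((\<lambda>t. sup (f t) (g t)) \<longlongrightarrow> sup a b) F"
proof (rule LIM_zero_cancel, rule Lim_null_comparison)
  show "\<forall>\<^sub>F t in F. norm (sup (f t) (g t) - sup a b) \<le> norm (f t - a) + norm (g t - b)"
    by (intro always_eventually allI norm_sup_diff_le)
  show "((\<lambda>t. norm (f t - a) + norm (g t - b)) \<longlongrightarrow> 0) F"
    using tendsto_add[OF tendsto_norm[OF LIM_zero[OF assms(1)]] tendsto_norm[OF LIM_zero[OF assms(2)]]]
    by simp
qed

lemma sup_zero_add_le: "sup (x + y) 0 \<le> sup x 0 + sup y (0::'a::banach_lattice)"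
  by (simp add: add_mono)

lemma sublinear_norm_pprt: "sublinear (\<lambda>v::'a::banach_lattice. norm (sup v 0))"
  unfolding sublinear_def
proof (intro conjI allI impI)
  fix x y :: 'a
  have "norm (sup (x + y) 0) \<le> norm (sup x 0 + sup y 0)"
    by (intro norm_mono_nonneg sup_zero_add_le) simp
  then show "norm (sup (x + y) 0) \<le> norm (sup x 0) + norm (sup y 0)"
    using norm_triangle_ineq order.trans by blast
next
  fix c :: real and x :: 'a
  assume "0 \<le> c"
  then show "norm (sup (c *\<^sub>R x) 0) = c * norm (sup x 0)"
    using scaleR_sup[of c x 0] by (metis abs_of_nonneg norm_scaleR scaleR_zero_right)
qed

lemma pos_dual_mono: "pos_dual \<phi> \<Longrightarrow> x \<le> y \<Longrightarrow> \<phi> x \<le> \<phi> y"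
  unfolding pos_dual_def by (metis blinfun.diff_right diff_ge_0_iff_ge)

lemma sublinear_pos_dual_pprt:
  assumes "pos_dual \<phi>"
  shows "sublinear (\<lambda>v. \<phi> (sup v 0))"
  unfolding sublinear_def
proof (intro conjI allI impI)
  fix x y
  show "\<phi> (sup (x + y) 0) \<le> \<phi> (sup x 0) + \<phi> (sup y 0)"
    using pos_dual_mono[OF assms sup_zero_add_le, of x y] by (simp add: blinfun.add_right)
next
  fix c :: real and x
  assume "0 \<le> c"
  then show "\<phi> (sup (c *\<^sub>R x) 0) = c * \<phi> (sup x 0)"
    using scaleR_sup[of c x 0] by (metis blinfun.scaleR_right real_scaleR_def scaleR_zero_right)
qed

lemma linear_nonneg_of_le:
  fixes f :: "'a::banach_lattice \<Rightarrow> real"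
  assumes "linear f" "\<And>v. f v \<le> q (sup v 0)" "q 0 = (0::real)" "0 \<le> v"
  shows "0 \<le> f v"
proof -
  have "sup (- v) 0 = 0" using \<open>0 \<le> v\<close> by (simp add: sup_absorb2)
  then show ?thesis using assms(2)[of "- v"] assms(3) by (simp add: linear_neg[OF assms(1)])
qed

lemma norming_pos_dual:
  fixes w :: "'a::banach_lattice"
  assumes "0 \<le> w"
  obtains \<phi> where "pos_dual \<phi>" "norm \<phi> \<le> 1" "\<phi> w = norm w"
proof -
  obtain f where f: "linear f" "\<And>v. f v \<le> norm (sup v 0)" "f w = norm (sup w 0)"
    using hahn_banach_point[OF sublinear_norm_pprt] by metis
  have "norm (sup v 0) \<le> norm v" for v :: 'a
    using norm_mono_nonneg[of "sup v 0" "labs v"] by (simp add: le_labs labs_nonneg)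
  then have "\<bar>f v\<bar> \<le> norm v" for v
    using f(2)[of v] f(2)[of "- v"] linear_neg[OF f(1), of v]
    by (smt (verit) norm_minus_cancel)
  then have bl: "bounded_linear f"
    using f(1) by (intro bounded_linear_intro[of _ 1]) (auto simp: linear_add linear_cmul)
  show thesis
  proof
    show "pos_dual (Blinfun f)"
      unfolding pos_dual_def using linear_nonneg_of_le[OF f(1), of norm] f(2)
      by (auto simp: bounded_linear_Blinfun_apply[OF bl])
    show "norm (Blinfun f) \<le> 1"
      by (rule norm_blinfun_bound) (use \<open>\<And>v. \<bar>f v\<bar> \<le> norm v\<close> in \<open>simp_all add: bounded_linear_Blinfun_apply[OF bl]\<close>)
    show "Blinfun f w = norm w"
      using f(3) assms by (simp add: bounded_linear_Blinfun_apply[OF bl] sup_absorb1)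
  qed
qed

lemma pos_dual_sup_split:
  fixes \<phi> :: "'a::banach_lattice \<Rightarrow>\<^sub>L real"
  assumes "pos_dual \<phi>"
  obtains \<phi>1 \<phi>2 where "pos_dual \<phi>1" "pos_dual \<phi>2" "\<phi> = \<phi>1 + \<phi>2" "\<phi> (sup a b) = \<phi>1 a + \<phi>2 b"
proof -
  obtain f where f: "linear f" "\<And>v. f v \<le> \<phi> (sup v 0)" "f (a - b) = \<phi> (sup (a - b) 0)"
    using hahn_banach_point[OF sublinear_pos_dual_pprt[OF assms]] by metis
  have "\<phi> (sup v 0) \<le> norm \<phi> * norm v" for v
  proof -
    have "norm (sup v 0) \<le> norm v"
      using norm_mono_nonneg[of "sup v 0" "labs v"] by (simp add: le_labs labs_nonneg)
    then have "norm \<phi> * norm (sup v 0) \<le> norm \<phi> * norm v" by (simp add: mult_left_mono)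
    then show ?thesis using norm_blinfun[of \<phi> "sup v 0"] by simp
  qed
  then have "\<bar>f v\<bar> \<le> norm \<phi> * norm v" for v
    using f(2)[of v] f(2)[of "- v"] linear_neg[OF f(1), of v]
    by (smt (verit) norm_minus_cancel)
  then have bl: "bounded_linear f"
    using f(1) by (intro bounded_linear_intro[of _ "norm \<phi>"]) (auto simp: linear_add linear_cmul mult.commute)
  note f_apply = bounded_linear_Blinfun_apply[OF bl]
  show thesis
  proof
    show "pos_dual (Blinfun f)"
      unfolding pos_dual_def using linear_nonneg_of_le[OF f(1), of \<phi>] f(2) by (auto simp: f_apply)
    show "pos_dual (\<phi> - Blinfun f)"
      unfolding pos_dual_def using f(2) by (auto simp: f_apply blinfun.diff_left) (metis sup_absorb1)
    show "\<phi> = Blinfun f + (\<phi> - Blinfun f)" by simp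
    have "sup a b = b + sup (a - b) 0" by (simp add: add_sup_distrib_left)
    then have "\<phi> (sup a b) = \<phi> b + f (a - b)" by (simp add: blinfun.add_right f(3))
    also have "\<dots> = f a + (\<phi> b - f b)" by (simp add: linear_diff[OF f(1)])
    finally show "\<phi> (sup a b) = Blinfun f a + (\<phi> - Blinfun f) b"
      by (simp add: f_apply blinfun.diff_left)
  qed
qed

section \<open>The Krivine functional calculus\<close>

inductive lattice_poly ::
  "nat \<Rightarrow> (nat \<Rightarrow> 'a::banach_lattice) \<Rightarrow> ((nat \<Rightarrow> real) \<Rightarrow> real) \<Rightarrow> 'a \<Rightarrow> bool" for n x where
  zero: "lattice_poly n x (\<lambda>t. 0) 0"
| coord: "j < n \<Longrightarrow> lattice_poly n x (\<lambda>t. t j) (x j)"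
| scale: "lattice_poly n x f u \<Longrightarrow> lattice_poly n x (\<lambda>t. c * f t) (c *\<^sub>R u)"
| add: "lattice_poly n x f u \<Longrightarrow> lattice_poly n x g v \<Longrightarrow> lattice_poly n x (\<lambda>t. f t + g t) (u + v)"
| max: "lattice_poly n x f u \<Longrightarrow> lattice_poly n x g v \<Longrightarrow> lattice_poly n x (\<lambda>t. max (f t) (g t)) (sup u v)"

definition max_linear ::
  "nat \<Rightarrow> (nat \<Rightarrow> 'a::banach_lattice) \<Rightarrow> (nat \<Rightarrow> real) set \<Rightarrow> ((nat \<Rightarrow> real) \<Rightarrow> real) \<Rightarrow> 'a \<Rightarrow> bool" where
  "max_linear n x A f u \<longleftrightarrow>
     (\<forall>t. \<forall>a\<in>A. (\<Sum>j<n. a j * t j) \<le> f t) \<and> (\<forall>t. \<exists>a\<in>A. f t = (\<Sum>j<n. a j * t j))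
   \<and> (\<forall>a\<in>A. (\<Sum>j<n. a j *\<^sub>R x j) \<le> u) \<and> (\<forall>v. (\<forall>a\<in>A. (\<Sum>j<n. a j *\<^sub>R x j) \<le> v) \<longrightarrow> u \<le> v)"

lemma max_linearI:
  assumes "\<And>t a. a \<in> A \<Longrightarrow> (\<Sum>j<n. a j * t j) \<le> f t" "\<And>t. \<exists>a\<in>A. f t = (\<Sum>j<n. a j * t j)"
    "\<And>a. a \<in> A \<Longrightarrow> (\<Sum>j<n. a j *\<^sub>R x j) \<le> u"
    "\<And>v. (\<And>a. a \<in> A \<Longrightarrow> (\<Sum>j<n. a j *\<^sub>R x j) \<le> v) \<Longrightarrow> u \<le> v"
  shows "max_linear n x A f u"
  using assms by (simp add: max_linear_def)

lemma max_linearD: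
  assumes "max_linear n x A f u"
  shows "a \<in> A \<Longrightarrow> (\<Sum>j<n. a j * t j) \<le> f t" "\<exists>a\<in>A. f t = (\<Sum>j<n. a j * t j)"
    "a \<in> A \<Longrightarrow> (\<Sum>j<n. a j *\<^sub>R x j) \<le> u"
    "(\<And>a. a \<in> A \<Longrightarrow> (\<Sum>j<n. a j *\<^sub>R x j) \<le> v) \<Longrightarrow> u \<le> v"
  using assms by (simp_all add: max_linear_def)

lemma max_linear_single:
  "max_linear n x {a} (\<lambda>t. \<Sum>j<n. a j * t j) (\<Sum>j<n. a j *\<^sub>R x j)"
  by (rule max_linearI) auto

lemma max_linear_zero: "max_linear n x {\<lambda>_. 0} (\<lambda>t. 0) 0"
  by (rule max_linearI) auto

lemma max_linear_scale:
  assumes A: "max_linear n x A f u" and c: "0 \<le> c"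
  shows "\<exists>B. max_linear n x B (\<lambda>t. c * f t) (c *\<^sub>R u)"
proof (cases "c = 0")
  case True
  then show ?thesis using max_linear_zero by auto
next
  case False
  with c have c: "c > 0" by simp
  have eq: "(\<Sum>j<n. (c * a j) * t j) = c * (\<Sum>j<n. a j * t j)"
    "(\<Sum>j<n. (c * a j) *\<^sub>R x j) = c *\<^sub>R (\<Sum>j<n. a j *\<^sub>R x j)" for a t
    by (simp_all add: sum_distrib_left scaleR_right.sum mult.assoc)
  have "max_linear n x ((\<lambda>a j. c * a j) ` A) (\<lambda>t. c * f t) (c *\<^sub>R u)"
  proof (rule max_linearI)
    fix t show "\<exists>a\<in>(\<lambda>a j. c * a j) ` A. c * f t = (\<Sum>j<n. a j * t j)"
      using max_linearD(2)[OF A, of t] eq by fastforce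
  next
    fix v assume *: "\<And>a. a \<in> (\<lambda>a j. c * a j) ` A \<Longrightarrow> (\<Sum>j<n. a j *\<^sub>R x j) \<le> v"
    have "u \<le> inverse c *\<^sub>R v"
    proof (rule max_linearD(4)[OF A])
      fix a assume "a \<in> A"
      then have "c *\<^sub>R (\<Sum>j<n. a j *\<^sub>R x j) \<le> v" using *[of "\<lambda>j. c * a j"] eq by auto
      from scaleR_left_mono[OF this, of "inverse c"] show "(\<Sum>j<n. a j *\<^sub>R x j) \<le> inverse c *\<^sub>R v"
        using c by simp
    qed
    from scaleR_left_mono[OF this, of c] show "c *\<^sub>R u \<le> v" using c by simp
  qed (use c max_linearD[OF A] eq in \<open>auto intro!: mult_left_mono scaleR_left_mono\<close>)
  then show ?thesis by blast
qed

lemma max_linear_add: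
  assumes A: "max_linear n x A f u" and B: "max_linear n x B g v"
  shows "\<exists>C. max_linear n x C (\<lambda>t. f t + g t) (u + v)"
proof -
  let ?C = "(\<lambda>(a, b) j. a j + b j) ` (A \<times> B)"
  have eq: "(\<Sum>j<n. (a j + b j) * t j) = (\<Sum>j<n. a j * t j) + (\<Sum>j<n. b j * t j)"
    "(\<Sum>j<n. (a j + b j) *\<^sub>R x j) = (\<Sum>j<n. a j *\<^sub>R x j) + (\<Sum>j<n. b j *\<^sub>R x j)" for a b t
    by (simp_all add: distrib_right scaleR_add_left sum.distrib)
  have "max_linear n x ?C (\<lambda>t. f t + g t) (u + v)"
  proof (rule max_linearI)
    fix t
    obtain a b where "a \<in> A" "b \<in> B" "f t = (\<Sum>j<n. a j * t j)" "g t = (\<Sum>j<n. b j * t j)"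
      using max_linearD(2)[OF A, of t] max_linearD(2)[OF B, of t] by blast
    then show "\<exists>c\<in>?C. f t + g t = (\<Sum>j<n. c j * t j)"
      by (intro bexI[of _ "\<lambda>j. a j + b j"]) (auto simp: eq)
  next
    fix w assume "\<And>c. c \<in> ?C \<Longrightarrow> (\<Sum>j<n. c j *\<^sub>R x j) \<le> w"
    then have *: "(\<Sum>j<n. a j *\<^sub>R x j) + (\<Sum>j<n. b j *\<^sub>R x j) \<le> w" if "a \<in> A" "b \<in> B" for a b
      using that by (fastforce simp flip: eq)
    have "u \<le> w - (\<Sum>j<n. b j *\<^sub>R x j)" if "b \<in> B" for b
      using *[OF _ that] by (intro max_linearD(4)[OF A]) (simp add: le_diff_eq)
    then have "v \<le> w - u"
      by (intro max_linearD(4)[OF B]) (simp add: le_diff_eq add.commute)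
    then show "u + v \<le> w" by (simp add: le_diff_eq add.commute)
  qed (use max_linearD[OF A] max_linearD[OF B] eq in \<open>auto intro!: add_mono\<close>)
  then show ?thesis by blast
qed

lemma max_linear_max:
  assumes A: "max_linear n x A f u" and B: "max_linear n x B g v"
  shows "max_linear n x (A \<union> B) (\<lambda>t. max (f t) (g t)) (sup u v)"
proof (rule max_linearI)
  fix t show "\<exists>a\<in>A \<union> B. max (f t) (g t) = (\<Sum>j<n. a j * t j)"
    using max_linearD(2)[OF A, of t] max_linearD(2)[OF B, of t] by (auto simp: max_def)
next
  fix w assume "\<And>a. a \<in> A \<union> B \<Longrightarrow> (\<Sum>j<n. a j *\<^sub>R x j) \<le> w"
  then show "sup u v \<le> w" using max_linearD(4)[OF A, of w] max_linearD(4)[OF B, of w] by auto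
qed (use max_linearD[OF A] max_linearD[OF B] in \<open>auto simp: le_max_iff_disj intro: le_supI1 le_supI2\<close>)

lemma max_linear_mono:
  assumes A: "max_linear n x A f u" and B: "max_linear n x B g v" and le: "\<And>t. f t \<le> g t"
  shows "u \<le> v"
proof (rule max_linearD(4)[OF A])
  fix a assume "a \<in> A"
  define e where "e = (\<Sum>j<n. labs (x j))"
  show "(\<Sum>j<n. a j *\<^sub>R x j) \<le> v"
  proof (rule archimedean_le)
    fix \<epsilon> :: real assume "\<epsilon> > 0"
    have "(\<Sum>k<n. w k * a k) \<le> s"
      if s: "\<And>d. d \<in> convex hull B \<Longrightarrow> (\<Sum>k<n. w k * d k) \<le> s" for w s
    proof -
      obtain b where b: "b \<in> B" "g w = (\<Sum>j<n. b j * w j)" using max_linearD(2)[OF B, of w] by auto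
      have "(\<Sum>k<n. a k * w k) \<le> g w"
        using max_linearD(1)[OF A \<open>a \<in> A\<close>, of w] le[of w] by simp
      also have "\<dots> \<le> s" using b s[of b] by (simp add: hull_inc mult.commute)
      finally show ?thesis by (simp add: mult.commute)
    qed
    then obtain d where d: "d \<in> convex hull B" "\<And>k. k < n \<Longrightarrow> \<bar>a k - d k\<bar> < \<epsilon>"
      using convex_approx_point[OF convex_convex_hull _ \<open>\<epsilon> > 0\<close>, of B n a] by blast
    have "convex {d. (\<Sum>j<n. d j *\<^sub>R x j) \<le> v}"
      unfolding convex_def
    proof safe
      fix c d :: "nat \<Rightarrow> real" and s t :: real
      assume *: "(\<Sum>j<n. c j *\<^sub>R x j) \<le> v" "(\<Sum>j<n. d j *\<^sub>R x j) \<le> v" "0 \<le> s" "0 \<le> t" "s + t = 1"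
      have "(\<Sum>j<n. (s *\<^sub>R c + t *\<^sub>R d) j *\<^sub>R x j) = s *\<^sub>R (\<Sum>j<n. c j *\<^sub>R x j) + t *\<^sub>R (\<Sum>j<n. d j *\<^sub>R x j)"
        by (simp add: scaleR_add_left sum.distrib scaleR_right.sum)
      also have "\<dots> \<le> s *\<^sub>R v + t *\<^sub>R v" using * by (intro add_mono scaleR_left_mono)
      also have "\<dots> = v" using * by (simp flip: scaleR_add_left)
      finally show "(\<Sum>j<n. (s *\<^sub>R c + t *\<^sub>R d) j *\<^sub>R x j) \<le> v" .
    qed
    then have "convex hull B \<subseteq> {d. (\<Sum>j<n. d j *\<^sub>R x j) \<le> v}"
      using max_linearD(3)[OF B] by (intro hull_minimal) auto
    with d have dv: "(\<Sum>j<n. d j *\<^sub>R x j) \<le> v" by auto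
    have "(\<Sum>j<n. a j *\<^sub>R x j) = (\<Sum>j<n. d j *\<^sub>R x j) + (\<Sum>j<n. (a j - d j) *\<^sub>R x j)"
      by (simp add: algebra_simps flip: sum.distrib)
    also have "\<dots> \<le> v + (\<Sum>j<n. \<epsilon> *\<^sub>R labs (x j))"
    proof (intro add_mono dv sum_mono)
      fix j assume "j \<in> {..<n}"
      then have "\<bar>a j - d j\<bar> *\<^sub>R labs (x j) \<le> \<epsilon> *\<^sub>R labs (x j)"
        using d(2)[of j] by (intro scaleR_right_mono labs_nonneg) auto
      then show "(a j - d j) *\<^sub>R x j \<le> \<epsilon> *\<^sub>R labs (x j)"
        using scaleR_le_labs order.trans by blast
    qed
    finally show "(\<Sum>j<n. a j *\<^sub>R x j) \<le> v + \<epsilon> *\<^sub>R e"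
      by (simp add: e_def scaleR_right.sum)
  qed
qed

text \<open>Writing lattice polynomials as differences of maxima of linear functions reduces their
positivity to the finite-dimensional separation theorem.\<close>

lemma lattice_poly_max_linear:
  assumes "lattice_poly n x f w"
  shows "\<exists>A B g h u v. max_linear n x A g u \<and> max_linear n x B h v \<and> (\<forall>t. f t = g t - h t) \<and> w = u - v"
  using assms
proof induction
  case zero
  show ?case using max_linear_zero[of n x] by fastforce
next
  case (coord j)
  have 1: "(\<Sum>i<n. (if i = j then 1 else 0) * t i) = t j" for t :: "nat \<Rightarrow> real"
    using coord by (simp add: if_distrib[of "\<lambda>c. c * _"] cong: if_cong)
  have 2: "(\<Sum>i<n. (if i = j then 1 else 0 :: real) *\<^sub>R x i) = x j"
    using coord by (simp add: if_distrib[of "\<lambda>c. c *\<^sub>R _"] cong: if_cong)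
  have "max_linear n x {\<lambda>i. if i = j then 1 else 0} (\<lambda>t. t j) (x j)"
    using max_linear_single[of n x "\<lambda>i. if i = j then 1 else 0"] unfolding 1 2 .
  with max_linear_zero[of n x] show ?case by fastforce
next
  case (scale f w c)
  then obtain A B g h u v where *: "max_linear n x A g u" "max_linear n x B h v"
    "\<And>t. f t = g t - h t" "w = u - v" by blast
  show ?case
  proof (cases "c \<ge> 0")
    case True
    obtain A' B' where "max_linear n x A' (\<lambda>t. c * g t) (c *\<^sub>R u)" "max_linear n x B' (\<lambda>t. c * h t) (c *\<^sub>R v)"
      using max_linear_scale[OF *(1) True] max_linear_scale[OF *(2) True] by blast
    moreover have "\<forall>t. c * f t = c * g t - c * h t" "c *\<^sub>R w = c *\<^sub>R u - c *\<^sub>R v"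
      unfolding *(3,4) by (simp_all add: algebra_simps)
    ultimately show ?thesis by blast
  next
    case False
    then have "0 \<le> - c" by simp
    obtain A' B' where "max_linear n x A' (\<lambda>t. - c * g t) (- c *\<^sub>R u)" "max_linear n x B' (\<lambda>t. - c * h t) (- c *\<^sub>R v)"
      using max_linear_scale[OF *(1) \<open>0 \<le> - c\<close>] max_linear_scale[OF *(2) \<open>0 \<le> - c\<close>] by blast
    moreover have "\<forall>t. c * f t = - c * h t - (- c * g t)" "c *\<^sub>R w = - c *\<^sub>R v - (- c *\<^sub>R u)"
      unfolding *(3,4) by (simp_all add: algebra_simps)
    ultimately show ?thesis by blast
  qed
next
  case (add f w f' w')
  then obtain A B g h u v A' B' g' h' u' v' where *: "max_linear n x A g u" "max_linear n x B h v"
    "\<And>t. f t = g t - h t" "w = u - v" "max_linear n x A' g' u'" "max_linear n x B' h' v'"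
    "\<And>t. f' t = g' t - h' t" "w' = u' - v'" by blast
  obtain C D where "max_linear n x C (\<lambda>t. g t + g' t) (u + u')" "max_linear n x D (\<lambda>t. h t + h' t) (v + v')"
    using max_linear_add[OF *(1,5)] max_linear_add[OF *(2,6)] by blast
  moreover have "\<forall>t. f t + f' t = g t + g' t - (h t + h' t)" "w + w' = u + u' - (v + v')"
    using * by simp_all
  ultimately show ?case by blast
next
  case (max f w f' w')
  then obtain A B g h u v A' B' g' h' u' v' where *: "max_linear n x A g u" "max_linear n x B h v"
    "\<And>t. f t = g t - h t" "w = u - v" "max_linear n x A' g' u'" "max_linear n x B' h' v'"
    "\<And>t. f' t = g' t - h' t" "w' = u' - v'" by blast
  obtain C D E where C: "max_linear n x C (\<lambda>t. g t + h' t) (u + v')"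
    and D: "max_linear n x D (\<lambda>t. g' t + h t) (u' + v)" and E: "max_linear n x E (\<lambda>t. h t + h' t) (v + v')"
    using max_linear_add[OF *(1,6)] max_linear_add[OF *(5,2)] max_linear_add[OF *(2,6)] by blast
  have "\<forall>t. max (f t) (f' t) = max (g t + h' t) (g' t + h t) - (h t + h' t)"
    using * by (simp add: max_def)
  moreover have "sup w w' = sup (u + v') (u' + v) - (v + v')"
  proof -
    have "u - v + (v + v') = u + v'" "u' - v' + (v + v') = u' + v" by simp_all
    then have "sup w w' + (v + v') = sup (u + v') (u' + v)"
      by (simp only: *(4,8) add_sup_distrib_right)
    then show ?thesis by (metis add_diff_cancel)
  qed
  ultimately show ?case using max_linear_max[OF C D] E by blast
qed

lemma lattice_poly_mono:
  assumes f: "lattice_poly n x f w" and f': "lattice_poly n x f' w'" and le: "\<And>t. f t \<le> f' t"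
  shows "w \<le> w'"
proof -
  obtain A B g h u v A' B' g' h' u' v' where *: "max_linear n x A g u" "max_linear n x B h v"
    "\<And>t. f t = g t - h t" "w = u - v" "max_linear n x A' g' u'" "max_linear n x B' h' v'"
    "\<And>t. f' t = g' t - h' t" "w' = u' - v'"
    using lattice_poly_max_linear[OF f] lattice_poly_max_linear[OF f'] by blast
  obtain C D where C: "max_linear n x C (\<lambda>t. g t + h' t) (u + v')"
    and D: "max_linear n x D (\<lambda>t. g' t + h t) (u' + v)"
    using max_linear_add[OF *(1,6)] max_linear_add[OF *(5,2)] by blast
  have "u + v' \<le> u' + v"
  proof (rule max_linear_mono[OF C D])
    show "g t + h' t \<le> g' t + h t" for t using le[of t] * by simp
  qed
  then show ?thesis by (simp add: * algebra_simps)
qed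

lemma HnD:
  assumes "h \<in> Hn n"
  shows "continuous_on UNIV h" "(\<And>j. j < n \<Longrightarrow> t j = s j) \<Longrightarrow> h t = h s"
    "0 \<le> c \<Longrightarrow> h (\<lambda>j. c * t j) = c * h t"
  using assms by (auto simp: Hn_def)

lemma Hn_lin:
  assumes h: "h \<in> Hn n" and g: "g \<in> Hn n"
  shows "(\<lambda>t. a * h t + b * g t) \<in> Hn n"
  unfolding Hn_def
proof (intro CollectI conjI allI impI)
  show "continuous_on UNIV (\<lambda>t. a * h t + b * g t)"
    by (intro continuous_intros HnD(1)[OF h] HnD(1)[OF g])
  show "a * h t + b * g t = a * h s + b * g s" if "\<forall>j<n. t j = s j" for t s
    using HnD(2)[OF h, of t s] HnD(2)[OF g, of t s] that by simp
  show "a * h (\<lambda>j. c * t j) + b * g (\<lambda>j. c * t j) = c * (a * h t + b * g t)" if "0 \<le> c" for c t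
    using that by (simp add: HnD(3)[OF h] HnD(3)[OF g] algebra_simps)
qed

lemma Hn_max:
  assumes h: "h \<in> Hn n" and g: "g \<in> Hn n"
  shows "(\<lambda>t. max (h t) (g t)) \<in> Hn n"
  unfolding Hn_def
proof (intro CollectI conjI allI impI)
  show "continuous_on UNIV (\<lambda>t. max (h t) (g t))"
    by (intro continuous_intros HnD(1)[OF h] HnD(1)[OF g])
  show "max (h t) (g t) = max (h s) (g s)" if "\<forall>j<n. t j = s j" for t s
    using HnD(2)[OF h, of t s] HnD(2)[OF g, of t s] that by simp
  show "max (h (\<lambda>j. c * t j)) (g (\<lambda>j. c * t j)) = c * max (h t) (g t)" if "0 \<le> c" for c t
    using that by (simp add: HnD(3)[OF h] HnD(3)[OF g] max_mult_distrib_left)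
qed

lemma Hn_coord: "j < n \<Longrightarrow> (\<lambda>t. t j) \<in> Hn n"
  by (simp add: Hn_def)

lemma Hn_zero: "(\<lambda>t. 0) \<in> Hn n"
  by (simp add: Hn_def)

lemma lattice_poly_Hn: "lattice_poly n x f w \<Longrightarrow> f \<in> Hn n"
proof (induction rule: lattice_poly.induct)
  case (scale f u c)
  then show ?case using Hn_lin[of f n f c 0] by simp
next
  case (add f u g v)
  then show ?case using Hn_lin[of f n g 1 1] by simp
qed (simp_all add: Hn_zero Hn_coord Hn_max)

lemma lattice_poly_abs:
  assumes "lattice_poly n x f u"
  shows "lattice_poly n x (\<lambda>t. \<bar>f t\<bar>) (labs u)"
proof -
  have "(\<lambda>t. max (f t) (- 1 * f t)) = (\<lambda>t. \<bar>f t\<bar>)" by (auto simp: fun_eq_iff)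
  then show ?thesis
    using lattice_poly.max[OF assms lattice_poly.scale[OF assms, of "- 1"]] by (simp add: labs_def)
qed

lemma lattice_poly_sum:
  "finite I \<Longrightarrow> (\<And>i. i \<in> I \<Longrightarrow> lattice_poly n x (F i) (u i)) \<Longrightarrow>
    lattice_poly n x (\<lambda>t. \<Sum>i\<in>I. F i t) (\<Sum>i\<in>I. u i)"
  by (induction I rule: finite_induct) (simp_all add: lattice_poly.zero lattice_poly.add)

definition l1 :: "nat \<Rightarrow> (nat \<Rightarrow> real) \<Rightarrow> real" where
  "l1 n t = (\<Sum>j<n. \<bar>t j\<bar>)"

lemma l1_nonneg: "0 \<le> l1 n t"
  by (simp add: l1_def sum_nonneg)

lemma lattice_poly_l1: "lattice_poly n x (l1 n) (\<Sum>j<n. labs (x j))"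
  unfolding l1_def[abs_def] by (intro lattice_poly_sum lattice_poly_abs lattice_poly.coord) auto

lemma lattice_poly_linear:
  "lattice_poly n x (\<lambda>t. \<Sum>j<n. a j * t j) (\<Sum>j<n. a j *\<^sub>R x j)"
  by (intro lattice_poly_sum lattice_poly.scale lattice_poly.coord) auto

lemma lattice_poly_diff:
  assumes "lattice_poly n x f u" "lattice_poly n x g v"
  shows "lattice_poly n x (\<lambda>t. f t - g t) (u - v)"
  using lattice_poly.add[OF assms(1) lattice_poly.scale[OF assms(2), of "-1"]] by simp

lemma lattice_poly_min:
  assumes "lattice_poly n x f u" "lattice_poly n x g v"
  shows "\<exists>w. lattice_poly n x (\<lambda>t. min (f t) (g t)) w"
proof -
  have "(\<lambda>t. min (f t) (g t)) = (\<lambda>t. f t + g t - max (f t) (g t))" by (auto simp: min_def max_def)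
  then show ?thesis
    using lattice_poly_diff[OF lattice_poly.add[OF assms] lattice_poly.max[OF assms]] by auto
qed

lemma lattice_poly_Min:
  assumes "finite F" "F \<noteq> {}" "\<And>s. s \<in> F \<Longrightarrow> \<exists>w. lattice_poly n x (f s) w"
  shows "\<exists>w. lattice_poly n x (\<lambda>t. MIN s\<in>F. f s t) w"
  using assms
proof (induction F rule: finite_ne_induct)
  case (insert s F)
  then obtain u v where "lattice_poly n x (f s) u" "lattice_poly n x (\<lambda>t. MIN s\<in>F. f s t) v" by force
  with lattice_poly_min[OF this] insert.hyps show ?case by simp
qed simp

lemma compact_l1_sphere: "compact {t. (\<forall>j\<ge>n. t j = 0) \<and> l1 n t = 1}" (is "compact ?S")
proof -
  let ?P = "PiE (UNIV::nat set) (\<lambda>_. {-1..1::real})"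
  have "compactin (product_topology (\<lambda>_. euclidean) UNIV) ?P"
    by (simp add: compactin_PiE)
  then have "compact ?P"
    by (simp add: euclidean_product_topology)
  moreover have "closed ?S"
  proof (intro closed_Collect_conj closed_Collect_all)
    show "closed {t::nat \<Rightarrow> real. n \<le> j \<longrightarrow> t j = 0}" for j
      by (cases "n \<le> j") (simp_all add: closed_Collect_eq)
    show "closed {t. l1 n t = 1}"
      unfolding l1_def by (intro closed_Collect_eq continuous_intros continuous_on_product_coordinates)
  qed
  ultimately have "compact (?P \<inter> ?S)" by (rule compact_Int_closed)
  moreover have "?P \<inter> ?S = ?S"
  proof -
    have "\<bar>t j\<bar> \<le> 1" if "\<forall>j\<ge>n. t j = 0" "l1 n t = 1" for t j
      using that member_le_sum[of j "{..<n}" "\<lambda>j. \<bar>t j\<bar>"] by (cases "j < n") (auto simp: l1_def)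
    then show ?thesis by (fastforce simp: abs_le_iff)
  qed
  ultimately show ?thesis by simp
qed

text \<open>Every \<open>h \<in> Hn n\<close> is approximated on the unit sphere by the infimum of finitely many of the
functions \<open>h s * l1 n t + C * (\<Sum>j<n. \<bar>t j - s j * l1 n t\<bar>)\<close>, which on the sphere are cones with
vertex at \<open>s\<close>.\<close>

lemma lattice_poly_cone:
  "\<exists>w. lattice_poly n x (\<lambda>t. b * l1 n t + C * (\<Sum>j<n. \<bar>t j - s j * l1 n t\<bar>)) w"
proof
  let ?E = "\<Sum>j<n. labs (x j)"
  show "lattice_poly n x (\<lambda>t. b * l1 n t + C * (\<Sum>j<n. \<bar>t j - s j * l1 n t\<bar>))
      (b *\<^sub>R ?E + C *\<^sub>R (\<Sum>j<n. labs (x j - s j *\<^sub>R ?E)))"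
    by (intro lattice_poly.add lattice_poly.scale lattice_poly_l1 lattice_poly_sum lattice_poly_abs
      lattice_poly_diff lattice_poly.coord) auto
qed

lemma Hn_cone_above:
  assumes h: "h \<in> Hn n" and "0 < \<epsilon>"
  shows "\<exists>C. \<forall>t. (\<forall>j\<ge>n. t j = 0) \<and> l1 n t = 1 \<longrightarrow> h t \<le> h s + C * (\<Sum>j<n. \<bar>t j - s j\<bar>) + \<epsilon>"
proof -
  define S where "S = {t. (\<forall>j\<ge>n. t j = 0) \<and> l1 n t = 1}"
  define d where "d t = (\<Sum>j<n. \<bar>t j - s j\<bar>)" for t
  have cont_d: "continuous_on A d" for A
    unfolding d_def
    by (intro continuous_intros continuous_on_subset[OF continuous_on_product_coordinates]) auto
  note cont_h = continuous_on_subset[OF HnD(1)[OF h]]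
  define K where "K = S \<inter> {t. h s + \<epsilon> \<le> h t}"
  have "compact K"
    unfolding K_def using compact_l1_sphere[of n]
    by (intro compact_Int_closed closed_Collect_le continuous_intros HnD(1)[OF h]) (simp add: S_def)
  have d_pos: "0 < d t" if "t \<in> K" for t
  proof -
    have "0 \<le> d t" by (simp add: d_def sum_nonneg)
    moreover have "d t \<noteq> 0"
    proof
      assume "d t = 0"
      then have "t j = s j" if "j < n" for j using that by (simp add: d_def sum_nonneg_eq_0_iff)
      then have "h t = h s" by (rule HnD(2)[OF h])
      with \<open>t \<in> K\<close> \<open>0 < \<epsilon>\<close> show False by (simp add: K_def)
    qed
    ultimately show ?thesis by simp
  qed
  have "continuous_on K (\<lambda>t. (h t - h s) / d t)"
    using d_pos by (intro continuous_intros cont_h cont_d) fastforce+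
  then have "bounded ((\<lambda>t. (h t - h s) / d t) ` K)"
    using \<open>compact K\<close> compact_continuous_image compact_imp_bounded by blast
  then obtain C where C: "\<And>t. t \<in> K \<Longrightarrow> \<bar>(h t - h s) / d t\<bar> \<le> C" "0 < C"
    by (auto simp: bounded_pos)
  have "h t \<le> h s + C * (\<Sum>j<n. \<bar>t j - s j\<bar>) + \<epsilon>" if "t \<in> S" for t
  proof -
    have "0 \<le> d t" by (simp add: d_def sum_nonneg)
    show "h t \<le> h s + C * (\<Sum>j<n. \<bar>t j - s j\<bar>) + \<epsilon>"
    proof (cases "t \<in> K")
      case True
      then have "(h t - h s) / d t \<le> C" using C(1)[of t] by linarith
      then show ?thesis using d_pos[OF True] \<open>0 < \<epsilon>\<close> by (simp add: divide_le_eq flip: d_def)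
    next
      case False
      moreover have "0 \<le> C * d t" using C \<open>0 \<le> d t\<close> by simp
      ultimately show ?thesis using \<open>t \<in> S\<close> by (simp add: K_def flip: d_def)
    qed
  qed
  then show ?thesis by (auto simp: S_def)
qed

lemma Hn_bound_of_sphere:
  assumes h: "h \<in> Hn n" and f: "f \<in> Hn n"
    and le: "\<And>t. \<lbrakk>\<forall>j\<ge>n. t j = 0; l1 n t = 1\<rbrakk> \<Longrightarrow> \<bar>h t - f t\<bar> \<le> \<epsilon>"
  shows "\<bar>h t - f t\<bar> \<le> \<epsilon> * l1 n t"
proof (cases "l1 n t = 0")
  case True
  then have "t j = 0 * t j" if "j < n" for j using that by (simp add: l1_def sum_nonneg_eq_0_iff)
  then have "h t = h (\<lambda>j. 0 * t j)" "f t = f (\<lambda>j. 0 * t j)"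
    by (auto intro!: HnD(2)[OF h] HnD(2)[OF f])
  then show ?thesis using True HnD(3)[OF h, of 0 t] HnD(3)[OF f, of 0 t] by simp
next
  case False
  define m where "m = l1 n t"
  have m: "m > 0" using False l1_nonneg[of n t] by (simp add: m_def)
  define s where "s j = (if j < n then t j / m else 0)" for j
  have "l1 n s = 1" using m by (simp add: l1_def s_def m_def flip: sum_divide_distrib)
  then have "\<bar>h s - f s\<bar> \<le> \<epsilon>" by (intro le) (auto simp: s_def)
  moreover have "h t = h (\<lambda>j. m * s j)" "f t = f (\<lambda>j. m * s j)"
    using m by (auto intro!: HnD(2)[OF h] HnD(2)[OF f] simp: s_def)
  then have "\<bar>h t - f t\<bar> = m * \<bar>h s - f s\<bar>"
    using m by (simp add: HnD(3)[OF h] HnD(3)[OF f] abs_mult flip: right_diff_distrib)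
  ultimately show ?thesis using m by (simp add: mult.commute flip: m_def)
qed

lemma lattice_poly_dense:
  assumes h: "h \<in> Hn n" and "0 < \<epsilon>"
  obtains f w where "lattice_poly n x f w" "\<And>t. \<bar>h t - f t\<bar> \<le> \<epsilon> * l1 n t"
proof -
  define S where "S = {t. (\<forall>j\<ge>n. t j = 0) \<and> l1 n t = 1}"
  have "\<forall>s. \<exists>C. \<forall>t\<in>S. h t \<le> h s + C * (\<Sum>j<n. \<bar>t j - s j\<bar>) + \<epsilon>"
  proof
    fix s
    show "\<exists>C. \<forall>t\<in>S. h t \<le> h s + C * (\<Sum>j<n. \<bar>t j - s j\<bar>) + \<epsilon>"
      using Hn_cone_above[OF h \<open>0 < \<epsilon>\<close>, of s] by (simp add: S_def)
  qed
  from choice[OF this]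
  obtain C where C: "\<forall>s. \<forall>t\<in>S. h t \<le> h s + C s * (\<Sum>j<n. \<bar>t j - s j\<bar>) + \<epsilon>"
    by (rule exE)
  define g where "g s t = h s * l1 n t + C s * (\<Sum>j<n. \<bar>t j - s j * l1 n t\<bar>)" for s t
  have poly: "\<exists>w. lattice_poly n x (g s) w" for s
    unfolding g_def by (rule lattice_poly_cone)
  have cont: "continuous_on UNIV (g s)" for s
    using poly lattice_poly_Hn HnD(1) by blast
  define U where "U s = {t. g s t < h t + \<epsilon>}" for s
  have "compact S" unfolding S_def by (rule compact_l1_sphere)
  moreover have "open (U s)" for s
    unfolding U_def by (intro open_Collect_less continuous_intros cont HnD(1)[OF h])
  moreover have "S \<subseteq> (\<Union>s\<in>S. U s)"
    using \<open>0 < \<epsilon>\<close> by (auto simp: U_def g_def S_def)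
  ultimately obtain F where F: "F \<subseteq> S" "finite F" "S \<subseteq> (\<Union>s\<in>F. U s)"
    by (rule compactE_image)
  obtain f w where f: "lattice_poly n x f w" "\<And>t. t \<in> S \<Longrightarrow> \<bar>h t - f t\<bar> \<le> \<epsilon>"
  proof (cases "F = {}")
    case True
    then show thesis using F(3) that[OF lattice_poly.zero] by auto
  next
    case False
    obtain w where "lattice_poly n x (\<lambda>t. MIN s\<in>F. g s t) w"
      using lattice_poly_Min[of F n x g, OF F(2) False poly] by (rule exE)
    moreover have "\<bar>h t - (MIN s\<in>F. g s t)\<bar> \<le> \<epsilon>" if "t \<in> S" for t
    proof -
      obtain s where "s \<in> F" "g s t < h t + \<epsilon>" using F(3) \<open>t \<in> S\<close> by (auto simp: U_def)
      then have "(MIN s\<in>F. g s t) \<le> h t + \<epsilon>"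
        using F(2) by (meson Min_le finite_imageI imageI less_imp_le order_trans)
      moreover have "h t - \<epsilon> \<le> g s t" if "s \<in> F" for s
        using C[rule_format, of t s] that F(1) \<open>t \<in> S\<close> by (auto simp: g_def S_def)
      then have "h t - \<epsilon> \<le> (MIN s\<in>F. g s t)" using F(2) False by simp
      ultimately show ?thesis by linarith
    qed
    ultimately show thesis by (rule that)
  qed
  show thesis
    using f Hn_bound_of_sphere[OF h lattice_poly_Hn[OF f(1)]] by (intro that[OF f(1)]) (simp add: S_def)
qed

definition krivine_lim ::
  "nat \<Rightarrow> (nat \<Rightarrow> 'a::banach_lattice) \<Rightarrow> ((nat \<Rightarrow> real) \<Rightarrow> real) \<Rightarrow> 'a \<Rightarrow> bool" where
  "krivine_lim n x h z \<longleftrightarrow> (\<exists>F W e. (\<forall>k. lattice_poly n x (F k) (W k))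
     \<and> (\<forall>k t. \<bar>h t - F k t\<bar> \<le> e k * l1 n t) \<and> e \<longlonglongrightarrow> (0::real) \<and> W \<longlonglongrightarrow> z)"

lemma lattice_poly_dist:
  assumes f: "lattice_poly n x f u" and g: "lattice_poly n x g v"
    and le: "\<And>t. \<bar>f t - g t\<bar> \<le> \<epsilon> * l1 n t"
  shows "norm (u - v) \<le> \<bar>\<epsilon>\<bar> * norm (\<Sum>j<n. labs (x j))"
proof -
  note e = lattice_poly.scale[OF lattice_poly_l1, of n x \<epsilon>]
  have "f t - g t \<le> \<epsilon> * l1 n t" "g t - f t \<le> \<epsilon> * l1 n t" for t using le[of t] by linarith+
  then have "u - v \<le> \<epsilon> *\<^sub>R (\<Sum>j<n. labs (x j))" "v - u \<le> \<epsilon> *\<^sub>R (\<Sum>j<n. labs (x j))"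
    using lattice_poly_mono[OF lattice_poly_diff[OF f g] e] lattice_poly_mono[OF lattice_poly_diff[OF g f] e]
    by blast+
  then have "norm (u - v) \<le> norm (\<epsilon> *\<^sub>R (\<Sum>j<n. labs (x j)))" by (intro norm_le_of_abs_le) simp_all
  then show ?thesis by simp
qed

lemma krivine_lim_poly:
  assumes "lattice_poly n x f w" shows "krivine_lim n x f w"
  unfolding krivine_lim_def
  by (rule exI[of _ "\<lambda>_. f"], rule exI[of _ "\<lambda>_. w"], rule exI[of _ "\<lambda>_. 0"]) (simp add: assms)

lemma krivine_lim_unique:
  assumes "krivine_lim n x h z" "krivine_lim n x h z'"
  shows "z = z'"
proof -
  obtain F W e F' W' e' where *: "\<And>k. lattice_poly n x (F k) (W k)"
    "\<And>k t. \<bar>h t - F k t\<bar> \<le> e k * l1 n t" "e \<longlonglongrightarrow> 0" "W \<longlonglongrightarrow> z"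
    "\<And>k. lattice_poly n x (F' k) (W' k)"
    "\<And>k t. \<bar>h t - F' k t\<bar> \<le> e' k * l1 n t" "e' \<longlonglongrightarrow> 0" "W' \<longlonglongrightarrow> z'"
    using assms unfolding krivine_lim_def by blast
  let ?E = "norm (\<Sum>j<n. labs (x j))"
  have bound: "norm (W k - W' k) \<le> \<bar>e k + e' k\<bar> * ?E" for k
  proof (rule lattice_poly_dist[OF *(1,5)])
    show "\<bar>F k t - F' k t\<bar> \<le> (e k + e' k) * l1 n t" for t
      using *(2)[of t k] *(6)[of t k] unfolding distrib_right by linarith
  qed
  have "(\<lambda>k. W k - W' k) \<longlonglongrightarrow> 0"
  proof (rule Lim_null_comparison)
    show "\<forall>\<^sub>F k in sequentially. norm (W k - W' k) \<le> \<bar>e k + e' k\<bar> * ?E"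
      using bound by (intro always_eventually allI)
    have "(\<lambda>k. \<bar>e k + e' k\<bar> * ?E) \<longlonglongrightarrow> \<bar>0 + 0\<bar> * ?E"
      by (intro tendsto_intros *)
    then show "(\<lambda>k. \<bar>e k + e' k\<bar> * ?E) \<longlonglongrightarrow> 0" by simp
  qed
  moreover have "(\<lambda>k. W k - W' k) \<longlonglongrightarrow> z - z'" by (intro tendsto_intros *)
  ultimately have "z - z' = 0" by (rule LIMSEQ_unique[rotated])
  then show ?thesis by simp
qed

lemma krivine_lim_exists:
  assumes "h \<in> Hn n"
  shows "\<exists>z. krivine_lim n x h z"
proof -
  define e where "e k = inverse (real (Suc k))" for k
  have "\<exists>f w. lattice_poly n x f w \<and> (\<forall>t. \<bar>h t - f t\<bar> \<le> e k * l1 n t)" for k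
    using lattice_poly_dense[OF assms, of "e k" x] unfolding e_def by (metis inverse_positive_iff_positive of_nat_0_less_iff zero_less_Suc)
  then obtain F W where F: "\<And>k. lattice_poly n x (F k) (W k)" "\<And>k t. \<bar>h t - F k t\<bar> \<le> e k * l1 n t"
    by metis
  let ?E = "norm (\<Sum>j<n. labs (x j))"
  have e: "e \<longlonglongrightarrow> 0" unfolding e_def by (rule LIMSEQ_inverse_real_of_nat)
  have dist: "norm (W k - W l) \<le> e k * ?E + e l * ?E" for k l
  proof -
    have "norm (W k - W l) \<le> \<bar>e k + e l\<bar> * ?E"
    proof (rule lattice_poly_dist[OF F(1) F(1)])
      show "\<bar>F k t - F l t\<bar> \<le> (e k + e l) * l1 n t" for t
        using F(2)[of t k] F(2)[of t l] unfolding distrib_right by linarith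
    qed
    also have "\<bar>e k + e l\<bar> = e k + e l" by (simp add: e_def)
    finally show ?thesis by (simp add: distrib_right)
  qed
  have "Cauchy W"
  proof (rule CauchyI)
    fix \<delta> :: real assume "0 < \<delta>"
    have "(\<lambda>k. e k * ?E) \<longlonglongrightarrow> 0 * ?E" by (intro tendsto_intros e)
    then have "eventually (\<lambda>k. e k * ?E < \<delta> / 2) sequentially"
      using \<open>0 < \<delta>\<close> by (intro order_tendstoD(2)[of _ "0 * ?E"]) auto
    then obtain M where "\<And>k. k \<ge> M \<Longrightarrow> e k * ?E < \<delta> / 2" by (auto simp: eventually_sequentially)
    then have "norm (W k - W l) < \<delta>" if "k \<ge> M" "l \<ge> M" for k l
      using dist[of k l] that by (smt (verit) field_sum_of_halves)
    then show "\<exists>M. \<forall>k\<ge>M. \<forall>l\<ge>M. norm (W k - W l) < \<delta>" by blast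
  qed
  then obtain z where "W \<longlonglongrightarrow> z" using Cauchy_convergent convergent_def by blast
  with F e show ?thesis unfolding krivine_lim_def by blast
qed

lemma krivine_lim_lin:
  assumes "krivine_lim n x h z" "krivine_lim n x g y"
  shows "krivine_lim n x (\<lambda>t. a * h t + b * g t) (a *\<^sub>R z + b *\<^sub>R y)"
proof -
  obtain F W e F' W' e' where *: "\<And>k. lattice_poly n x (F k) (W k)"
    "\<And>k t. \<bar>h t - F k t\<bar> \<le> e k * l1 n t" "e \<longlonglongrightarrow> 0" "W \<longlonglongrightarrow> z"
    "\<And>k. lattice_poly n x (F' k) (W' k)"
    "\<And>k t. \<bar>g t - F' k t\<bar> \<le> e' k * l1 n t" "e' \<longlonglongrightarrow> 0" "W' \<longlonglongrightarrow> y"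
    using assms unfolding krivine_lim_def by blast
  have "\<bar>a * h t + b * g t - (a * F k t + b * F' k t)\<bar> \<le> (\<bar>a\<bar> * e k + \<bar>b\<bar> * e' k) * l1 n t" for k t
  proof -
    have "\<bar>a * h t + b * g t - (a * F k t + b * F' k t)\<bar> = \<bar>a * (h t - F k t) + b * (g t - F' k t)\<bar>"
      by (simp add: algebra_simps)
    also have "\<dots> \<le> \<bar>a\<bar> * \<bar>h t - F k t\<bar> + \<bar>b\<bar> * \<bar>g t - F' k t\<bar>"
      by (metis abs_mult abs_triangle_ineq)
    also have "\<dots> \<le> \<bar>a\<bar> * (e k * l1 n t) + \<bar>b\<bar> * (e' k * l1 n t)"
      using * by (intro add_mono mult_left_mono) auto
    finally show ?thesis by (simp add: algebra_simps)
  qed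
  moreover have "(\<lambda>k. \<bar>a\<bar> * e k + \<bar>b\<bar> * e' k) \<longlonglongrightarrow> 0"
    using tendsto_add[OF tendsto_mult_left[OF *(3), of "\<bar>a\<bar>"] tendsto_mult_left[OF *(7), of "\<bar>b\<bar>"]] by simp
  moreover have "(\<lambda>k. a *\<^sub>R W k + b *\<^sub>R W' k) \<longlonglongrightarrow> a *\<^sub>R z + b *\<^sub>R y"
    by (intro tendsto_intros *)
  moreover have "lattice_poly n x (\<lambda>t. a * F k t + b * F' k t) (a *\<^sub>R W k + b *\<^sub>R W' k)" for k
    by (intro lattice_poly.add lattice_poly.scale *)
  ultimately show ?thesis
    unfolding krivine_lim_def by (intro exI[of _ "\<lambda>k t. a * F k t + b * F' k t"] exI conjI allI) auto
qed

lemma krivine_lim_max: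
  assumes "krivine_lim n x h z" "krivine_lim n x g y"
  shows "krivine_lim n x (\<lambda>t. max (h t) (g t)) (sup z y)"
proof -
  obtain F W e F' W' e' where *: "\<And>k. lattice_poly n x (F k) (W k)"
    "\<And>k t. \<bar>h t - F k t\<bar> \<le> e k * l1 n t" "e \<longlonglongrightarrow> 0" "W \<longlonglongrightarrow> z"
    "\<And>k. lattice_poly n x (F' k) (W' k)"
    "\<And>k t. \<bar>g t - F' k t\<bar> \<le> e' k * l1 n t" "e' \<longlonglongrightarrow> 0" "W' \<longlonglongrightarrow> y"
    using assms unfolding krivine_lim_def by blast
  have "\<bar>max (h t) (g t) - max (F k t) (F' k t)\<bar> \<le> (e k + e' k) * l1 n t" for k t
    using *(2)[of t k] *(6)[of t k] unfolding distrib_right by linarith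
  moreover have "(\<lambda>k. e k + e' k) \<longlonglongrightarrow> 0"
    using tendsto_add[OF *(3) *(7)] by simp
  moreover have "(\<lambda>k. sup (W k) (W' k)) \<longlonglongrightarrow> sup z y"
    by (intro tendsto_sup_banach_lattice *)
  moreover have "lattice_poly n x (\<lambda>t. max (F k t) (F' k t)) (sup (W k) (W' k))" for k
    by (intro lattice_poly.max *)
  ultimately show ?thesis
    unfolding krivine_lim_def by (intro exI[of _ "\<lambda>k t. max (F k t) (F' k t)"] exI conjI allI) auto
qed

lemma krivine_hom_lin:
  "krivine_hom n x \<tau> \<Longrightarrow> h \<in> Hn n \<Longrightarrow> g \<in> Hn n \<Longrightarrow>
    \<tau> (\<lambda>t. a * h t + b * g t) = a *\<^sub>R \<tau> h + b *\<^sub>R \<tau> g"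
  unfolding krivine_hom_def by blast

lemma krivine_hom_poly:
  assumes \<tau>: "krivine_hom n x \<tau>" and f: "lattice_poly n x f w"
  shows "\<tau> f = w"
  using f
proof induction
  case zero
  show ?case using krivine_hom_lin[OF \<tau> Hn_zero Hn_zero, of 0 0] by simp
next
  case (coord j)
  then show ?case using \<tau> by (simp add: krivine_hom_def)
next
  case (scale f u c)
  note f = lattice_poly_Hn[OF scale.hyps]
  show ?case using krivine_hom_lin[OF \<tau> f f, of c 0] scale.IH by simp
next
  case (add f u g v)
  show ?case
    using krivine_hom_lin[OF \<tau> lattice_poly_Hn[OF add.hyps(1)] lattice_poly_Hn[OF add.hyps(2)], of 1 1]
      add.IH by simp
next
  case (max f u g v)
  have "\<tau> (\<lambda>t. max (f t) (g t)) = sup (\<tau> f) (\<tau> g)"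
    using \<tau> lattice_poly_Hn max.hyps unfolding krivine_hom_def by blast
  then show ?case using max.IH by simp
qed

lemma krivine_hom_mono:
  assumes \<tau>: "krivine_hom n x \<tau>" and "h \<in> Hn n" "g \<in> Hn n" and le: "\<And>t. h t \<le> g t"
  shows "\<tau> h \<le> \<tau> g"
proof -
  have "\<tau> (\<lambda>t. max (h t) (g t)) = sup (\<tau> h) (\<tau> g)"
    using assms unfolding krivine_hom_def by blast
  moreover have "(\<lambda>t. max (h t) (g t)) = g" using le by (auto simp: max_def fun_eq_iff antisym)
  ultimately show ?thesis by (metis sup_ge1)
qed

lemma krivine_hom_lim:
  assumes \<tau>: "krivine_hom n x \<tau>" and h: "h \<in> Hn n"
  shows "krivine_lim n x h (\<tau> h)"
proof -
  define e where "e k = inverse (real (Suc k))" for k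
  have "\<exists>f w. lattice_poly n x f w \<and> (\<forall>t. \<bar>h t - f t\<bar> \<le> e k * l1 n t)" for k
    using lattice_poly_dense[OF h, of "e k" x] unfolding e_def by (metis inverse_positive_iff_positive of_nat_0_less_iff zero_less_Suc)
  then obtain F W where F: "\<And>k. lattice_poly n x (F k) (W k)" "\<And>k t. \<bar>h t - F k t\<bar> \<le> e k * l1 n t"
    by metis
  let ?E = "\<Sum>j<n. labs (x j)"
  have e: "e \<longlonglongrightarrow> 0" unfolding e_def by (rule LIMSEQ_inverse_real_of_nat)
  have bound: "norm (W k - \<tau> h) \<le> e k * norm ?E" for k
  proof -
    have G: "lattice_poly n x (\<lambda>t. F k t + c * l1 n t) (W k + c *\<^sub>R ?E)" for c
      by (intro lattice_poly.add lattice_poly.scale F lattice_poly_l1)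
    note \<tau>G = krivine_hom_poly[OF \<tau> G]
    have "h t \<le> F k t + e k * l1 n t" "F k t + - e k * l1 n t \<le> h t" for t
      using F(2)[of t k] by (simp_all only: mult_minus_left abs_le_iff) linarith+
    then have "\<tau> h \<le> W k + e k *\<^sub>R ?E" "W k + - e k *\<^sub>R ?E \<le> \<tau> h"
      using krivine_hom_mono[OF \<tau> h lattice_poly_Hn[OF G], of "e k"]
        krivine_hom_mono[OF \<tau> lattice_poly_Hn[OF G] h, of "- e k"] unfolding \<tau>G by blast+
    then have "norm (W k - \<tau> h) \<le> norm (e k *\<^sub>R ?E)"
      by (intro norm_le_of_abs_le) (simp_all add: algebra_simps)
    then show ?thesis by (simp add: e_def)
  qed
  have "(\<lambda>k. W k - \<tau> h) \<longlonglongrightarrow> 0"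
  proof (rule Lim_null_comparison)
    show "\<forall>\<^sub>F k in sequentially. norm (W k - \<tau> h) \<le> e k * norm ?E"
      using bound by (intro always_eventually allI)
    show "(\<lambda>k. e k * norm ?E) \<longlonglongrightarrow> 0"
      using tendsto_mult_right[OF e, of "norm ?E"] by simp
  qed
  then have "W \<longlonglongrightarrow> \<tau> h" by (rule LIM_zero_cancel)
  with F e show ?thesis unfolding krivine_lim_def by blast
qed

lemma krivine_lim_calc:
  assumes h: "h \<in> Hn n"
  shows "krivine_lim n x h (krivine_calc n x h)"
proof -
  define \<tau> where "\<tau> g = (THE z. krivine_lim n x g z)" for g
  have \<tau>_eq: "\<tau> g = z" if "krivine_lim n x g z" for g z
    unfolding \<tau>_def using that krivine_lim_unique by blast
  have \<tau>_lim: "krivine_lim n x g (\<tau> g)" if "g \<in> Hn n" for g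
    using krivine_lim_exists[OF that] \<tau>_eq by blast
  have "krivine_hom n x \<tau>"
    unfolding krivine_hom_def
    by (intro conjI ballI allI impI \<tau>_eq krivine_lim_lin krivine_lim_max \<tau>_lim
        krivine_lim_poly lattice_poly.coord)
  then have "\<exists>!z. \<exists>\<tau>. krivine_hom n x \<tau> \<and> z = \<tau> h"
    using krivine_hom_lim[OF _ h] krivine_lim_unique by blast
  then have "\<exists>\<tau>. krivine_hom n x \<tau> \<and> krivine_calc n x h = \<tau> h"
    unfolding krivine_calc_def by (rule theI')
  then show ?thesis using krivine_hom_lim[OF _ h] by auto
qed

lemma linear_le_krivine_calc:
  assumes h: "h \<in> Hn n" and le: "\<And>t. (\<Sum>j<n. a j * t j) \<le> h t"
  shows "(\<Sum>j<n. a j *\<^sub>R x j) \<le> krivine_calc n x h"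
proof -
  note lim = krivine_lim_calc[OF h, of x]
  have eq: "(\<lambda>t. max (\<Sum>j<n. a j * t j) (h t)) = h" using le by (auto simp: fun_eq_iff max_def antisym)
  have "krivine_lim n x h (sup (\<Sum>j<n. a j *\<^sub>R x j) (krivine_calc n x h))"
    using krivine_lim_max[OF krivine_lim_poly[OF lattice_poly_linear[of n x a]] lim] unfolding eq .
  from krivine_lim_unique[OF this lim] show ?thesis by (metis sup_ge1)
qed

lemma pnorm_Hn:
  assumes p: "1 \<le> p"
  shows "pnorm p n \<in> Hn n"
  unfolding Hn_def
proof (intro CollectI conjI allI impI)
  show "continuous_on UNIV (pnorm p n)"
    unfolding pnorm_def[abs_def] using p
    by (intro continuous_on_powr' continuous_intros continuous_on_product_coordinates) (auto simp: sum_nonneg)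
  show "pnorm p n t = pnorm p n s" if "\<forall>j<n. t j = s j" for t s
    using that by (intro pnorm_cong) auto
  show "pnorm p n (\<lambda>j. c * t j) = c * pnorm p n t" if "0 \<le> c" for c t
    using that by (simp add: pnorm_scale[OF p])
qed

lemma linear_le_krivine_psum:
  assumes p: "1 \<le> p" and le: "\<And>t. (\<Sum>j<n. a j * t j) \<le> pnorm p n t"
  shows "(\<Sum>j<n. a j *\<^sub>R x j) \<le> krivine_psum p n x"
  using linear_le_krivine_calc[OF pnorm_Hn[OF p] le]
  unfolding krivine_psum_def pnorm_def[abs_def] .

section \<open>Finite Pietsch domination\<close>

lemma norm_blinfun_le_on_ball:
  fixes F :: "'x::real_normed_vector \<Rightarrow>\<^sub>L real"
  assumes "\<And>u. norm u \<le> 1 \<Longrightarrow> F u \<le> b"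
  shows "norm F \<le> b"
proof (rule norm_blinfun_bound)
  show "0 \<le> b" using assms[of 0] by simp
  fix x
  show "norm (F x) \<le> b * norm x"
  proof (cases "x = 0")
    case False
    let ?u = "(1 / norm x) *\<^sub>R x"
    have "F ?u \<le> b" "F (- ?u) \<le> b" using False by (intro assms; simp)+
    then have "F x / norm x \<le> b" "(- F x) / norm x \<le> b"
      by (simp_all add: blinfun.scaleR_right blinfun.minus_right)
    then have "F x \<le> b * norm x" "- F x \<le> b * norm x"
      using False by (simp_all only: pos_divide_le_eq zero_less_norm_iff not_False_eq_True)
    then show ?thesis by simp
  qed simp
qed

lemma psumming_const_le:
  fixes S :: "('x::real_normed_vector \<Rightarrow>\<^sub>L real) \<Rightarrow> 'f::real_normed_vector"
    and e :: "nat \<Rightarrow> 'x \<Rightarrow>\<^sub>L real"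
  assumes p: "1 \<le> p" and C: "psumming_const p S C"
    and bound: "\<And>u. norm u \<le> 1 \<Longrightarrow> C * pnorm p m (\<lambda>k. e k u) \<le> B"
  shows "pnorm p m (\<lambda>k. norm (S (e k))) \<le> B"
proof -
  have "0 \<le> C" using C by (simp add: psumming_const_def)
  have *: "pnorm p m (\<lambda>k. norm (S (e k)))
      \<le> C * (SUP f \<in> {f. norm f \<le> 1}. pnorm p m (\<lambda>k. blinfun_apply f (e k)))"
    using C by (simp add: psumming_const_def pnorm_def)
  show ?thesis
  proof (cases "C = 0")
    case True
    then show ?thesis using * bound[of 0] by simp
  next
    case False
    with \<open>0 \<le> C\<close> have "C > 0" by simp
    have "(SUP f \<in> {f. norm f \<le> 1}. pnorm p m (\<lambda>k. blinfun_apply f (e k))) \<le> B / C"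
    proof (rule cSUP_least)
      show "{f :: ('x \<Rightarrow>\<^sub>L real) \<Rightarrow>\<^sub>L real. norm f \<le> 1} \<noteq> {}" by (auto intro!: exI[of _ 0])
      fix f :: "('x \<Rightarrow>\<^sub>L real) \<Rightarrow>\<^sub>L real"
      assume "f \<in> {f. norm f \<le> 1}"
      then have f: "norm f \<le> 1" by simp
      obtain a where a: "\<And>t. (\<Sum>k<m. a k * t k) \<le> pnorm p m t"
        "(\<Sum>k<m. a k * f (e k)) = pnorm p m (\<lambda>k. f (e k))"
        using pnorm_norming[OF p, of m "\<lambda>k. f (e k)"] by blast
      have "(\<Sum>k<m. a k *\<^sub>R e k) u \<le> B / C" if "norm u \<le> 1" for u
      proof -
        have "(\<Sum>k<m. a k *\<^sub>R e k) u = (\<Sum>k<m. a k * e k u)"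
          by (simp add: blinfun.sum_left blinfun.scaleR_left)
        also have "\<dots> \<le> pnorm p m (\<lambda>k. e k u)" by (rule a)
        also have "\<dots> \<le> B / C" using bound[OF that] \<open>C > 0\<close> by (simp add: field_simps)
        finally show ?thesis .
      qed
      then have n: "norm (\<Sum>k<m. a k *\<^sub>R e k) \<le> B / C" by (rule norm_blinfun_le_on_ball)
      have "pnorm p m (\<lambda>k. f (e k)) = f (\<Sum>k<m. a k *\<^sub>R e k)"
        by (simp add: blinfun.sum_right blinfun.scaleR_right a(2))
      also have "\<dots> \<le> norm f * norm (\<Sum>k<m. a k *\<^sub>R e k)"
        using norm_blinfun[of f "\<Sum>k<m. a k *\<^sub>R e k"] by simp
      also have "\<dots> \<le> 1 * (B / C)" using f n by (intro mult_mono) auto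
      finally show "pnorm p m (\<lambda>k. f (e k)) \<le> B / C" by simp
    qed
    then have "C * (SUP f \<in> {f. norm f \<le> 1}. pnorm p m (\<lambda>k. blinfun_apply f (e k))) \<le> B"
      using \<open>C > 0\<close> by (simp add: field_simps)
    with * show ?thesis by simp
  qed
qed

lemma pietsch_finite_weights:
  fixes S :: "('x::real_normed_vector \<Rightarrow>\<^sub>L real) \<Rightarrow> 'f::real_normed_vector"
    and \<psi> :: "nat \<Rightarrow> 'x \<Rightarrow>\<^sub>L real"
  assumes p: "1 \<le> p" and S: "linear S" and C: "psumming_const p S C"
    and w: "\<And>k. k < m \<Longrightarrow> 0 \<le> w k"
    and bound: "\<And>u. norm u \<le> 1 \<Longrightarrow> (\<Sum>k<m. w k * (C powr p * \<bar>\<psi> k u\<bar> powr p)) \<le> s"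
  shows "(\<Sum>k<m. w k * norm (S (\<psi> k)) powr p) \<le> s"
proof -
  have "0 \<le> C" using C by (simp add: psumming_const_def)
  have "0 \<le> (\<Sum>k<m. w k * (C powr p * \<bar>\<psi> k 0\<bar> powr p))" using w by (intro sum_nonneg) auto
  then have "0 \<le> s" using bound[of 0] by simp
  define e where "e k = (w k powr (1 / p)) *\<^sub>R \<psi> k" for k
  have e: "\<bar>e k u\<bar> powr p = w k * \<bar>\<psi> k u\<bar> powr p" if "k < m" for k u
    using p w[OF that] by (simp add: e_def blinfun.scaleR_left abs_mult powr_mult powr_powr)
  have "pnorm p m (\<lambda>k. norm (S (e k))) \<le> s powr (1 / p)"
  proof (rule psumming_const_le[OF p C])
    fix u :: 'x assume u: "norm u \<le> 1"
    have "(C * pnorm p m (\<lambda>k. e k u)) powr p = C powr p * (\<Sum>k<m. \<bar>e k u\<bar> powr p)"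
      by (simp add: powr_mult pnorm_powr[OF p])
    also have "\<dots> = (\<Sum>k<m. w k * (C powr p * \<bar>\<psi> k u\<bar> powr p))"
      by (simp add: e sum_distrib_left mult.left_commute)
    also have "\<dots> \<le> s" by (rule bound[OF u])
    finally have "((C * pnorm p m (\<lambda>k. e k u)) powr p) powr (1 / p) \<le> s powr (1 / p)"
      using p by (intro powr_mono2) auto
    then show "C * pnorm p m (\<lambda>k. e k u) \<le> s powr (1 / p)"
      using p \<open>0 \<le> C\<close> by (simp add: powr_powr pnorm_nonneg)
  qed
  then have "(\<Sum>k<m. \<bar>norm (S (e k))\<bar> powr p) \<le> (s powr (1 / p)) powr p"
    using pnorm_le_iff[OF p] by simp
  also have "\<dots> = s" using p \<open>0 \<le> s\<close> by (simp add: powr_powr)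
  also have "(\<Sum>k<m. \<bar>norm (S (e k))\<bar> powr p) = (\<Sum>k<m. w k * norm (S (\<psi> k)) powr p)"
    using p w by (intro sum.cong) (auto simp: e_def linear_cmul[OF S] powr_mult powr_powr)
  finally show ?thesis .
qed

lemma pietsch_finite:
  fixes S :: "('x::real_normed_vector \<Rightarrow>\<^sub>L real) \<Rightarrow> 'f::real_normed_vector"
    and \<psi> :: "nat \<Rightarrow> 'x \<Rightarrow>\<^sub>L real"
  assumes p: "1 \<le> p" and S: "linear S" and C: "psumming_const p S C" and "0 < \<epsilon>"
  obtains N \<theta> u where "\<And>i. i < (N::nat) \<Longrightarrow> 0 \<le> \<theta> i" "\<And>i. i < N \<Longrightarrow> norm (u i) \<le> 1" "(\<Sum>i<N. \<theta> i) = 1"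
    "\<And>k. k < m \<Longrightarrow> norm (S (\<psi> k)) powr p \<le> C powr p * (\<Sum>i<N. \<theta> i * \<bar>\<psi> k (u i)\<bar> powr p) + \<epsilon>"
proof -
  define G where "G = (\<lambda>u k. C powr p * \<bar>\<psi> k u\<bar> powr p) ` cball 0 1"
  define D where "D = {v. \<exists>g\<in>convex hull G. \<forall>k<m. v k \<le> g k}"
  have conv: "convex D"
    unfolding convex_def
  proof (intro ballI allI impI)
    fix v v' :: "nat \<Rightarrow> real" and s t :: real
    assume "v \<in> D" "v' \<in> D" and st: "0 \<le> s" "0 \<le> t" "s + t = 1"
    then obtain g g' where g: "g \<in> convex hull G" "\<forall>k<m. v k \<le> g k"
      "g' \<in> convex hull G" "\<forall>k<m. v' k \<le> g' k" by (auto simp: D_def)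
    have "s *\<^sub>R g + t *\<^sub>R g' \<in> convex hull G"
      using convexD[OF convex_convex_hull g(1,3) st] .
    moreover have "\<forall>k<m. (s *\<^sub>R v + t *\<^sub>R v') k \<le> (s *\<^sub>R g + t *\<^sub>R g') k"
      using g st by (auto intro!: add_mono mult_left_mono)
    ultimately show "s *\<^sub>R v + t *\<^sub>R v' \<in> D" unfolding D_def by blast
  qed
  have supp: "(\<Sum>k<m. w k * norm (S (\<psi> k)) powr p) \<le> s"
    if s: "\<And>d. d \<in> D \<Longrightarrow> (\<Sum>k<m. w k * d k) \<le> s" for w s
  proof (rule pietsch_finite_weights[OF p S C])
    have GD: "g \<in> D" if "g \<in> G" for g using that hull_inc[of g G] by (auto simp: D_def)
    show "(\<Sum>k<m. w k * (C powr p * \<bar>\<psi> k u\<bar> powr p)) \<le> s" if "norm u \<le> 1" for u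
      using that by (intro s GD) (auto simp: G_def)
    fix k assume k: "k < m"
    show "0 \<le> w k"
    proof (rule ccontr)
      assume neg: "\<not> 0 \<le> w k"
      define g where "g = (\<lambda>k. C powr p * \<bar>\<psi> k 0\<bar> powr p)"
      have g: "g \<in> G" unfolding G_def g_def by (rule imageI) simp
      define r where "r = (s - (\<Sum>k<m. w k * g k) + 1) / - w k"
      have "0 \<le> r" using neg s[OF GD[OF g]] by (simp add: r_def divide_nonneg_neg)
      define v where "v = (\<lambda>j. g j - (if j = k then r else 0))"
      have "v \<in> D" using g \<open>0 \<le> r\<close> hull_inc[of g G] by (auto simp: D_def v_def intro!: bexI[of _ g])
      have "(\<Sum>j<m. w j * v j) = (\<Sum>j<m. w j * g j) - w k * r"
        using k by (simp add: v_def right_diff_distrib sum_subtractf if_distrib[of "\<lambda>c. _ * c"] cong: if_cong)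
      also have "\<dots> = s + 1" using neg by (simp add: r_def)
      finally show False using s[OF \<open>v \<in> D\<close>] by simp
    qed
  qed
  obtain d where d: "d \<in> D" "\<And>k. k < m \<Longrightarrow> \<bar>norm (S (\<psi> k)) powr p - d k\<bar> < \<epsilon>"
  proof (rule convex_approx_point[OF conv supp \<open>0 < \<epsilon>\<close>])
    fix d
    assume "d \<in> D" "\<And>k. k < m \<Longrightarrow> \<bar>norm (S (\<psi> k)) powr p - d k\<bar> < \<epsilon>"
    then show thesis by (rule that)
  qed
  obtain g where g: "g \<in> convex hull G" "\<forall>k<m. d k \<le> g k" using d(1) by (auto simp: D_def)
  have "\<exists>(N::nat) \<mu> gs. (\<forall>i\<in>{1..N}. 0 \<le> \<mu> i \<and> gs i \<in> G) \<and> sum \<mu> {1..N} = 1 \<and> (\<Sum>i = 1..N. \<mu> i *\<^sub>R gs i) = g"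
    using g(1) unfolding convex_hull_indexed mem_Collect_eq .
  then obtain N :: nat and \<mu> gs where N: "\<forall>i\<in>{1..N}. 0 \<le> \<mu> i \<and> gs i \<in> G" "sum \<mu> {1..N} = 1"
    "(\<Sum>i = 1..N. \<mu> i *\<^sub>R gs i) = g"
    by (elim exE conjE) (rule that)
  have "\<forall>i\<in>{1..N}. \<exists>u. norm u \<le> 1 \<and> gs i = (\<lambda>k. C powr p * \<bar>\<psi> k u\<bar> powr p)"
  proof
    fix i assume "i \<in> {1..N}"
    then have "gs i \<in> G" using N(1) by blast
    then show "\<exists>u. norm u \<le> 1 \<and> gs i = (\<lambda>k. C powr p * \<bar>\<psi> k u\<bar> powr p)"
      unfolding G_def by (rule imageE) (auto simp: dist_norm)
  qed
  from bchoice[OF this] obtain u where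
    u: "\<forall>i\<in>{1..N}. norm (u i) \<le> 1 \<and> gs i = (\<lambda>k. C powr p * \<bar>\<psi> k (u i)\<bar> powr p)"
    by (rule exE)
  show thesis
  proof (rule that[of N "\<lambda>i. \<mu> (Suc i)" "\<lambda>i. u (Suc i)"])
    show "0 \<le> \<mu> (Suc i)" "norm (u (Suc i)) \<le> 1" if "i < N" for i
      using bspec[OF N(1), of "Suc i"] bspec[OF u, of "Suc i"] that by auto
    show "(\<Sum>i<N. \<mu> (Suc i)) = 1" using N(2) by (simp add: sum.atLeast1_atMost_eq)
    fix k assume k: "k < m"
    have "g k = (\<Sum>i = 1..N. \<mu> i * (C powr p * \<bar>\<psi> k (u i)\<bar> powr p))"
      unfolding N(3)[symmetric] sum_fun_apply using u by (intro sum.cong) simp_all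
    also have "\<dots> = C powr p * (\<Sum>i<N. \<mu> (Suc i) * \<bar>\<psi> k (u (Suc i))\<bar> powr p)"
      by (simp add: sum.atLeast1_atMost_eq sum_distrib_left mult.left_commute)
    finally show "norm (S (\<psi> k)) powr p
        \<le> C powr p * (\<Sum>i<N. \<mu> (Suc i) * \<bar>\<psi> k (u (Suc i))\<bar> powr p) + \<epsilon>"
      using d(2)[OF k] g(2) k by force
  qed
qed

section \<open>The main inequality\<close>

lemma linear_dual_op: "linear (dual_op T)"
  by (rule linearI) (simp_all add: dual_op_def blinfun_eqI blinfun.add_left blinfun.scaleR_left)

lemma pnorm_le_krivine_psum:
  fixes \<phi> :: "'l::banach_lattice \<Rightarrow>\<^sub>L real" and x :: "nat \<Rightarrow> 'l"
  assumes p: "1 \<le> p" and \<phi>: "pos_dual \<phi>"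
  shows "pnorm p N (\<lambda>i. \<phi> (x i)) \<le> \<phi> (krivine_psum p N x)"
proof -
  obtain a where a: "\<And>t. (\<Sum>i<N. a i * t i) \<le> pnorm p N t"
    "(\<Sum>i<N. a i * \<phi> (x i)) = pnorm p N (\<lambda>i. \<phi> (x i))"
    using pnorm_norming[OF p, of N "\<lambda>i. \<phi> (x i)"] by blast
  have "pnorm p N (\<lambda>i. \<phi> (x i)) = \<phi> (\<Sum>i<N. a i *\<^sub>R x i)"
    by (simp add: a(2) blinfun.sum_right blinfun.scaleR_right)
  also have "\<dots> \<le> \<phi> (krivine_psum p N x)"
    by (intro pos_dual_mono[OF \<phi>] linear_le_krivine_psum[OF p] a)
  finally show ?thesis .
qed

context
  fixes p :: real
    and J :: "'x::banach \<Rightarrow> 'l::banach_lattice"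
    and T :: "'y::banach \<Rightarrow>\<^sub>L 'x"
    and K C :: real
  assumes p: "1 \<le> p" and J: "bounded_linear J"
    and K: "pconvex_const p J K" and C: "psumming_const p (dual_op T) C"
begin

lemma const_nonneg: "1 \<le> K" "0 \<le> C"
  using K C by (auto simp: pconvex_const_def psumming_const_def)

lemma sum_pos_dual_le:
  fixes \<phi> :: "nat \<Rightarrow> 'l \<Rightarrow>\<^sub>L real"
  assumes \<phi>: "\<And>k. k < m \<Longrightarrow> pos_dual (\<phi> k)" and y: "\<And>k. k < m \<Longrightarrow> norm (y k) \<le> 1"
  shows "(\<Sum>k<m. \<phi> k (J (T (y k)))) \<le> K * C * norm (\<Sum>k<m. \<phi> k)"
proof (rule field_le_epsilon)
  fix \<eta> :: real assume "0 < \<eta>"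
  define \<delta> where "\<delta> = \<eta> / (real m + 1)"
  have "0 < \<delta>" using \<open>0 < \<eta>\<close> by (simp add: \<delta>_def add_nonneg_pos)
  define \<psi> where "\<psi> k = \<phi> k o\<^sub>L Blinfun J" for k
  have \<psi>: "\<psi> k u = \<phi> k (J u)" for k u
    by (simp add: \<psi>_def bounded_linear_Blinfun_apply[OF J])
  let ?a = "\<lambda>k. norm (dual_op T (\<psi> k))"
  obtain N \<theta> u where \<theta>: "\<And>i. i < (N::nat) \<Longrightarrow> 0 \<le> \<theta> i" "\<And>i. i < N \<Longrightarrow> norm (u i) \<le> 1" "(\<Sum>i<N. \<theta> i) = 1"
    "\<And>k. k < m \<Longrightarrow> ?a k powr p \<le> C powr p * (\<Sum>i<N. \<theta> i * \<bar>\<psi> k (u i)\<bar> powr p) + \<delta> powr p"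
    using pietsch_finite[OF p linear_dual_op C, of "\<delta> powr p" m \<psi>] \<open>0 < \<delta>\<close> by auto
  define v where "v i = (\<theta> i powr (1 / p)) *\<^sub>R u i" for i
  define Z where "Z = krivine_psum p N (\<lambda>i. J (v i))"
  have "norm Z \<le> K * (\<Sum>i<N. norm (v i) powr p) powr (1 / p)"
    using K by (simp add: pconvex_const_def Z_def)
  also have "\<dots> \<le> K * 1 powr (1 / p)"
  proof (intro mult_left_mono powr_mono2 sum_nonneg)
    have "norm (v i) powr p \<le> \<theta> i * 1" if "i < N" for i
      using \<theta>(1,2)[OF that] p powr_mono2[of p "norm (u i)" 1]
      by (simp add: v_def powr_mult powr_powr mult_left_le)
    then have "(\<Sum>i<N. norm (v i) powr p) \<le> (\<Sum>i<N. \<theta> i)" by (intro sum_mono) auto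
    then show "(\<Sum>i<N. norm (v i) powr p) \<le> 1" by (simp add: \<theta>(3))
  qed (use p const_nonneg in auto)
  finally have Z: "norm Z \<le> K" by simp
  have le: "\<phi> k (J (T (y k))) \<le> C * \<phi> k Z + \<delta>" if k: "k < m" for k
  proof -
    have "\<phi> k (J (T (y k))) = dual_op T (\<psi> k) (y k)" by (simp add: dual_op_def \<psi>)
    also have "\<dots> \<le> ?a k * norm (y k)"
      using norm_blinfun[of "dual_op T (\<psi> k)" "y k"] by simp
    also have "\<dots> \<le> ?a k" using y[OF k] by (simp add: mult_left_le)
    also have "\<dots> = (?a k powr p) powr (1 / p)" using p by (simp add: powr_powr)
    also have "\<dots> \<le> (C powr p * (\<Sum>i<N. \<theta> i * \<bar>\<psi> k (u i)\<bar> powr p) + \<delta> powr p) powr (1 / p)"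
      using p by (intro powr_mono2 \<theta>(4) k) auto
    also have "\<dots> \<le> (C powr p * (\<Sum>i<N. \<theta> i * \<bar>\<psi> k (u i)\<bar> powr p)) powr (1 / p) + (\<delta> powr p) powr (1 / p)"
      by (intro powr_inverse_add_le p mult_nonneg_nonneg sum_nonneg) (use \<theta>(1) in auto)
    also have "(\<Sum>i<N. \<theta> i * \<bar>\<psi> k (u i)\<bar> powr p) = (\<Sum>i<N. \<bar>\<phi> k (J (v i))\<bar> powr p)"
    proof (intro sum.cong refl)
      fix i assume "i \<in> {..<N}"
      then show "\<theta> i * \<bar>\<psi> k (u i)\<bar> powr p = \<bar>\<phi> k (J (v i))\<bar> powr p"
        using p \<theta>(1)[of i]
        by (simp add: \<psi> v_def linear_cmul[OF bounded_linear.linear[OF J]] blinfun.scaleR_right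
            abs_mult powr_mult powr_powr)
    qed
    also have "(C powr p * (\<Sum>i<N. \<bar>\<phi> k (J (v i))\<bar> powr p)) powr (1 / p) + (\<delta> powr p) powr (1 / p)
        = C * pnorm p N (\<lambda>i. \<phi> k (J (v i))) + \<delta>"
      using p const_nonneg \<open>0 < \<delta>\<close> by (simp add: powr_mult powr_powr pnorm_def)
    also have "\<dots> \<le> C * \<phi> k Z + \<delta>"
      using pnorm_le_krivine_psum[OF p \<phi>[OF k], of N "\<lambda>i. J (v i)"] const_nonneg
      by (simp add: Z_def mult_left_mono)
    finally show ?thesis .
  qed
  have "(\<Sum>k<m. \<phi> k (J (T (y k)))) \<le> (\<Sum>k<m. C * \<phi> k Z + \<delta>)"
    using le by (intro sum_mono) auto
  also have "\<dots> = C * (\<Sum>k<m. \<phi> k) Z + real m * \<delta>"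
    by (simp add: sum.distrib blinfun.sum_left sum_distrib_left)
  also have "\<dots> \<le> C * (norm (\<Sum>k<m. \<phi> k) * K) + \<eta>"
  proof (intro add_mono mult_left_mono const_nonneg)
    have "(\<Sum>k<m. \<phi> k) Z \<le> norm (\<Sum>k<m. \<phi> k) * norm Z"
      using norm_blinfun[of "\<Sum>k<m. \<phi> k" Z] by simp
    also have "\<dots> \<le> norm (\<Sum>k<m. \<phi> k) * K" using Z by (simp add: mult_left_mono)
    finally show "(\<Sum>k<m. \<phi> k) Z \<le> norm (\<Sum>k<m. \<phi> k) * K" .
    have "real m * \<eta> \<le> (real m + 1) * \<eta>" using \<open>0 < \<eta>\<close> by simp
    then show "real m * \<delta> \<le> \<eta>" by (simp add: \<delta>_def divide_le_eq add_nonneg_pos mult.commute)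
  qed
  finally show "(\<Sum>k<m. \<phi> k (J (T (y k)))) \<le> K * C * norm (\<Sum>k<m. \<phi> k) + \<eta>"
    by (simp add: mult.commute mult.left_commute)
qed

end

section \<open>Order boundedness\<close>

inductive_set decomposition_cone ::
  "('x::banach \<Rightarrow> 'l::banach_lattice) \<Rightarrow> ('y::real_normed_vector \<Rightarrow> 'x) \<Rightarrow> (('l \<Rightarrow>\<^sub>L real) \<times> real) set"
  for J T where
  zero: "(0, 0) \<in> decomposition_cone J T"
| step: "(\<phi>, r) \<in> decomposition_cone J T \<Longrightarrow> pos_dual \<psi> \<Longrightarrow> norm y \<le> 1 \<Longrightarrow>
    (\<phi> + \<psi>, r + \<psi> (J (T y))) \<in> decomposition_cone J T"

lemma decomposition_cone_single:
  assumes "pos_dual \<psi>" "norm y \<le> 1"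
  shows "(\<psi>, \<psi> (J (T y))) \<in> decomposition_cone J T"
  using decomposition_cone.step[OF decomposition_cone.zero assms] by simp

lemma decomposition_cone_add:
  assumes "(\<phi>, r) \<in> decomposition_cone J T" "(\<psi>, s) \<in> decomposition_cone J T"
  shows "(\<phi> + \<psi>, r + s) \<in> decomposition_cone J T"
  using assms(2)
proof induction
  case (step \<psi>1 s1 \<psi>2 y)
  then show ?case
    using decomposition_cone.step[OF step.IH step.hyps(2,3)] by (simp add: add.assoc)
qed (use assms(1) in simp)

lemma decomposition_cone_scale:
  assumes "(\<phi>, r) \<in> decomposition_cone J T" "0 < c"
  shows "(c *\<^sub>R \<phi>, c * r) \<in> decomposition_cone J T"
  using assms(1)
proof induction
  case zero
  show ?case using decomposition_cone.zero by simp
next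
  case (step \<phi> r \<psi> y)
  have "pos_dual (c *\<^sub>R \<psi>)"
    using step.hyps(2) \<open>0 < c\<close> by (simp add: pos_dual_def blinfun.scaleR_left)
  from decomposition_cone.step[OF step.IH this step.hyps(3)]
  show ?case by (simp add: blinfun.scaleR_left scaleR_add_right distrib_left)
qed

lemma decomposition_cone_family:
  assumes "(\<Phi>, r) \<in> decomposition_cone J T"
  shows "\<exists>m \<phi> y. (\<forall>k<m. pos_dual (\<phi> k)) \<and> (\<forall>k<m. norm (y k) \<le> 1)
    \<and> \<Phi> = (\<Sum>k<m. \<phi> k) \<and> r = (\<Sum>k<(m::nat). blinfun_apply (\<phi> k) (J (T (y k))))"
  using assms
proof induction
  case zero
  show ?case by (intro exI[of _ 0]) simp
next
  case (step \<Phi> r \<psi> y0)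
  then obtain m \<phi> y where *: "\<forall>k<m. pos_dual (\<phi> k)" "\<forall>k<m. norm (y k) \<le> 1"
    "\<Phi> = (\<Sum>k<m. \<phi> k)" "r = (\<Sum>k<(m::nat). blinfun_apply (\<phi> k) (J (T (y k))))" by blast
  show ?case
    using * step.hyps by (intro exI[of _ "Suc m"] exI[of _ "\<phi>(m := \<psi>)"] exI[of _ "y(m := y0)"]) (auto simp: less_Suc_eq)
qed

text \<open>Elements of \<open>L\<close> lying below the supremum of the image of the unit ball of \<open>Y\<close> in \<open>L**\<close>.\<close>

definition decomposable ::
  "('x::banach \<Rightarrow> 'l::banach_lattice) \<Rightarrow> ('y::real_normed_vector \<Rightarrow> 'x) \<Rightarrow> 'l set" where
  "decomposable J T = {w. \<forall>\<phi>. pos_dual \<phi> \<longrightarrow> (\<phi>, \<phi> w) \<in> decomposition_cone J T}"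

lemma decomposable_sup:
  fixes v w :: "'l::banach_lattice"
  assumes "v \<in> decomposable J T" "w \<in> decomposable J T"
  shows "sup v w \<in> decomposable J T"
  unfolding decomposable_def
proof (intro CollectI allI impI)
  fix \<phi> :: "'l \<Rightarrow>\<^sub>L real"
  assume "pos_dual \<phi>"
  then obtain \<phi>1 \<phi>2 where *: "pos_dual \<phi>1" "pos_dual \<phi>2" "\<phi> = \<phi>1 + \<phi>2" "\<phi> (sup v w) = \<phi>1 v + \<phi>2 w"
    by (rule pos_dual_sup_split)
  show "(\<phi>, \<phi> (sup v w)) \<in> decomposition_cone J T"
    unfolding *(4) unfolding *(3)
    using assms *(1,2) by (intro decomposition_cone_add) (auto simp: decomposable_def)
qed

lemma decomposable_upper_bound:
  assumes "finite F" "F \<noteq> {}" "F \<subseteq> cball 0 1"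
  shows "\<exists>w\<in>decomposable J T. \<forall>y\<in>F. J (T y) \<le> w"
  using assms
proof (induction F rule: finite_ne_induct)
  case (singleton y)
  then show ?case
    by (intro bexI[of _ "J (T y)"]) (auto simp: decomposable_def intro: decomposition_cone_single)
next
  case (insert y F)
  then obtain w where w: "w \<in> decomposable J T" "\<forall>y\<in>F. J (T y) \<le> w" by auto
  have "J (T y) \<in> decomposable J T"
    using insert.prems by (auto simp: decomposable_def intro: decomposition_cone_single)
  from decomposable_sup[OF this w(1)] w(2) show ?case
    by (intro bexI[of _ "sup (J (T y)) w"]) (auto intro: le_supI2)
qed

lemma minorant_cone_decomposition:
  assumes bound: "\<And>\<phi> r. (\<phi>, r) \<in> decomposition_cone J T \<Longrightarrow> r \<le> B * norm \<phi>"
  shows "minorant_cone (\<lambda>\<phi>. B * norm \<phi>) (decomposition_cone J T)"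
  unfolding minorant_cone_def
proof (intro conjI ballI allI impI)
  show "0 \<in> decomposition_cone J T" by (simp add: zero_prod_def decomposition_cone.zero)
  show "a + b \<in> decomposition_cone J T" if "a \<in> decomposition_cone J T" "b \<in> decomposition_cone J T" for a b
    using decomposition_cone_add[of "fst a" "snd a" J T "fst b" "snd b"] that
    by (simp add: plus_prod_def)
  show "c *\<^sub>R a \<in> decomposition_cone J T" if "0 < c" "a \<in> decomposition_cone J T" for c a
    using decomposition_cone_scale[of "fst a" "snd a" J T c] that by (simp add: scaleR_prod_def)
  show "snd a \<le> B * norm (fst a)" if "a \<in> decomposition_cone J T" for a
    using bound[of "fst a" "snd a"] that by simp
qed

lemma finite_net_of_functionals:
  fixes f :: "nat \<Rightarrow> 'y::real_normed_vector \<Rightarrow>\<^sub>L real"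
  assumes "0 < \<epsilon>"
  obtains F where "finite F" "F \<subseteq> cball 0 1"
    "\<And>y. norm y \<le> 1 \<Longrightarrow> \<exists>y'\<in>F. \<forall>j<n. \<bar>f j y - f j y'\<bar> \<le> \<epsilon>"
proof -
  define c where "c y = restrict (\<lambda>j. \<lfloor>f j y / \<epsilon>\<rfloor>) {..<n}" for y
  define M where "M j = \<lceil>norm (f j) / \<epsilon>\<rceil> + 1" for j
  have "c ` cball 0 1 \<subseteq> PiE {..<n} (\<lambda>j. {- M j..M j})"
  proof (intro image_subsetI PiE_I)
    fix y j assume "y \<in> cball (0::'y) 1" "j \<in> {..<n}"
    then have "norm (f j) * norm y \<le> norm (f j)" by (simp add: mult_left_le)
    then have "\<bar>f j y\<bar> \<le> norm (f j)" using norm_blinfun[of "f j" y] by simp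
    then have "\<bar>f j y / \<epsilon>\<bar> \<le> norm (f j) / \<epsilon>" using assms by (simp add: abs_divide divide_right_mono)
    then have "\<lfloor>f j y / \<epsilon>\<rfloor> \<le> M j" "- M j \<le> \<lfloor>f j y / \<epsilon>\<rfloor>" unfolding M_def by linarith+
    then show "c y j \<in> {- M j..M j}" using \<open>j \<in> {..<n}\<close> by (simp add: c_def)
  qed (simp add: c_def)
  then have fin: "finite (c ` cball 0 1)" by (rule finite_subset) (simp add: finite_PiE)
  let ?F = "inv_into (cball 0 1) c ` c ` cball 0 1"
  show thesis
  proof
    show "finite ?F" using fin by simp
    show "?F \<subseteq> cball 0 1" using inv_into_into[of _ c "cball 0 1"] by blast
    fix y :: 'y assume "norm y \<le> 1"
    then have y: "c y \<in> c ` cball 0 1" by simp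
    define y' where "y' = inv_into (cball 0 1) c (c y)"
    have "y' \<in> ?F" using y unfolding y'_def by (rule imageI)
    have "c y' = c y" unfolding y'_def using y by (rule f_inv_into_f)
    have "\<bar>f j y - f j y'\<bar> \<le> \<epsilon>" if "j < n" for j
    proof -
      have "\<lfloor>f j y' / \<epsilon>\<rfloor> = \<lfloor>f j y / \<epsilon>\<rfloor>"
        using fun_cong[OF \<open>c y' = c y\<close>, of j] that by (simp add: c_def)
      then have "\<bar>f j y / \<epsilon> - f j y' / \<epsilon>\<bar> \<le> 1" by linarith
      then have "\<bar>(f j y - f j y') / \<epsilon>\<bar> \<le> 1" by (simp add: diff_divide_distrib)
      then show ?thesis using assms by (simp add: abs_divide divide_le_eq)
    qed
    with \<open>y' \<in> ?F\<close> show "\<exists>y'\<in>?F. \<forall>j<n. \<bar>f j y - f j y'\<bar> \<le> \<epsilon>" by blast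
  qed
qed

lemma bidual_emb_apply: "bidual_emb x \<phi> = \<phi> x"
  unfolding bidual_emb_def
  by (subst bounded_linear_Blinfun_apply) (auto intro: bounded_linear_intros)

lemma psumming_const_finite_rank:
  fixes T :: "'y::real_normed_vector \<Rightarrow>\<^sub>L 'x::real_normed_vector"
    and f :: "nat \<Rightarrow> 'y \<Rightarrow>\<^sub>L real"
  assumes p: "1 \<le> p" and T: "\<And>y. T y = (\<Sum>j<n. f j y *\<^sub>R xs j)"
  shows "psumming_const p (dual_op T) (\<Sum>j<n. norm (f j) * norm (xs j))"
  unfolding psumming_const_def
proof (intro conjI allI)
  show "0 \<le> (\<Sum>j<n. norm (f j) * norm (xs j))" by (intro sum_nonneg) simp
  fix m and e :: "nat \<Rightarrow> 'x \<Rightarrow>\<^sub>L real"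
  let ?w = "\<lambda>F :: ('x \<Rightarrow>\<^sub>L real) \<Rightarrow>\<^sub>L real. pnorm p m (\<lambda>i. F (e i))"
  let ?W = "SUP F \<in> {F. norm F \<le> 1}. ?w F"
  have bdd: "bdd_above (?w ` {F. norm F \<le> 1})"
  proof (rule bdd_aboveI2)
    fix F :: "('x \<Rightarrow>\<^sub>L real) \<Rightarrow>\<^sub>L real" assume "F \<in> {F. norm F \<le> 1}"
    then have "\<bar>F (e i)\<bar> \<le> norm (e i)" for i
      using norm_blinfun[of F "e i"] mult_left_le_one_le[of "norm (e i)" "norm F"] by simp
    then show "?w F \<le> pnorm p m (\<lambda>i. norm (e i))" by (intro pnorm_mono[OF p]) auto
  qed
  have eval: "pnorm p m (\<lambda>i. e i x) \<le> norm x * ?W" for x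
  proof (cases "x = 0")
    case True
    then show ?thesis by (simp add: pnorm_def)
  next
    case False
    define F where "F = (1 / norm x) *\<^sub>R Blinfun (\<lambda>\<phi> :: 'x \<Rightarrow>\<^sub>L real. \<phi> x)"
    have F: "F \<phi> = \<phi> x / norm x" for \<phi>
      unfolding F_def blinfun.scaleR_left
      by (subst bounded_linear_Blinfun_apply) (auto intro: bounded_linear_intros)
    have "norm F \<le> 1"
    proof (rule norm_blinfun_bound)
      fix \<phi> show "norm (F \<phi>) \<le> 1 * norm \<phi>"
        using norm_blinfun[of \<phi> x] False by (simp add: F divide_le_eq)
    qed simp
    then have "?w F \<le> ?W" using bdd by (intro cSUP_upper) auto
    moreover have "pnorm p m (\<lambda>i. e i x) = norm x * ?w F"
      using pnorm_scale[OF p, of m "norm x" "\<lambda>i. F (e i)"] False by (simp add: F)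
    ultimately show ?thesis by (simp add: mult_left_mono)
  qed
  have dual: "norm (dual_op T \<phi>) \<le> (\<Sum>j<n. norm (f j) * \<bar>\<phi> (xs j)\<bar>)" for \<phi>
  proof -
    have "dual_op T \<phi> = (\<Sum>j<n. \<phi> (xs j) *\<^sub>R f j)"
      by (rule blinfun_eqI)
        (simp add: dual_op_def T blinfun.sum_left blinfun.sum_right blinfun.scaleR_left
          blinfun.scaleR_right mult.commute)
    then show ?thesis using norm_sum[of "\<lambda>j. \<phi> (xs j) *\<^sub>R f j" "{..<n}"] by (simp add: mult.commute)
  qed
  have "pnorm p m (\<lambda>i. norm (dual_op T (e i))) \<le> pnorm p m (\<lambda>i. \<Sum>j<n. norm (f j) * \<bar>e i (xs j)\<bar>)"
    using order.trans[OF dual abs_ge_self] by (intro pnorm_mono[OF p]) simp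
  also have "\<dots> \<le> (\<Sum>j<n. pnorm p m (\<lambda>i. norm (f j) * \<bar>e i (xs j)\<bar>))" by (rule pnorm_sum[OF p])
  also have "\<dots> = (\<Sum>j<n. norm (f j) * pnorm p m (\<lambda>i. e i (xs j)))"
    by (intro sum.cong refl) (simp add: pnorm_scale[OF p], simp add: pnorm_def)
  also have "\<dots> \<le> (\<Sum>j<n. norm (f j) * (norm (xs j) * ?W))"
    by (intro sum_mono mult_left_mono eval) simp
  also have "\<dots> = (\<Sum>j<n. norm (f j) * norm (xs j)) * ?W"
    by (simp add: sum_distrib_right mult.assoc)
  finally show "(\<Sum>i<m. norm (dual_op T (e i)) powr p) powr (1 / p)
      \<le> (\<Sum>j<n. norm (f j) * norm (xs j)) *
        (SUP F\<in>{F. norm F \<le> 1}. (\<Sum>i<m. \<bar>blinfun_apply F (e i)\<bar> powr p) powr (1 / p))"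
    by (simp add: pnorm_def)
qed

lemma ordbdd_L_byI:
  fixes T :: "'y::banach \<Rightarrow>\<^sub>L 'x::banach"
  assumes J: "bounded_linear J" and le: "\<And>y. norm y \<le> 1 \<Longrightarrow> J (T y) \<le> z"
  shows "ordbdd_L_by J T z"
proof -
  note J_linear = bounded_linear.linear[OF J]
  have le': "J (T y) \<le> norm y *\<^sub>R z" for y
  proof (cases "y = 0")
    case False
    have "norm y *\<^sub>R J (T ((1 / norm y) *\<^sub>R y)) \<le> norm y *\<^sub>R z"
      using False by (intro scaleR_left_mono le) auto
    then show ?thesis using False by (simp add: blinfun.scaleR_right linear_cmul[OF J_linear])
  qed (simp add: blinfun.zero_right linear_0[OF J_linear])
  have "labs (J (T y)) \<le> norm y *\<^sub>R z" for y
    using le'[of y] le'[of "- y"]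
    by (intro labs_leI) (simp_all add: blinfun.minus_right linear_neg[OF J_linear])
  moreover have "0 \<le> z" using le[of 0] by (simp add: blinfun.zero_right linear_0[OF J_linear])
  ultimately show ?thesis by (simp add: ordbdd_L_by_def)
qed

context
  fixes p :: real
    and J :: "'x::banach \<Rightarrow> 'l::banach_lattice"
    and T :: "'y::banach \<Rightarrow>\<^sub>L 'x"
    and K C :: real
  assumes p: "1 \<le> p" and J: "bounded_linear J"
    and K: "pconvex_const p J K" and C: "psumming_const p (dual_op T) C"
begin

lemma decomposition_cone_bound:
  assumes "(\<phi>, r) \<in> decomposition_cone J T"
  shows "r \<le> K * C * norm \<phi>"
  using decomposition_cone_family[OF assms] sum_pos_dual_le[OF p J K C] by force

lemma KC_nonneg: "0 \<le> K * C"
  using const_nonneg[OF p J K C] by simp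

lemma norm_decomposable_le:
  assumes "w \<in> decomposable J T" "0 \<le> w"
  shows "norm w \<le> K * C"
proof -
  obtain \<phi> where \<phi>: "pos_dual \<phi>" "norm \<phi> \<le> 1" "\<phi> w = norm w"
    using norming_pos_dual[OF \<open>0 \<le> w\<close>] by blast
  have "norm w \<le> K * C * norm \<phi>"
    using assms \<phi> by (intro decomposition_cone_bound) (metis (mono_tags, lifting) decomposable_def mem_Collect_eq)
  also have "\<dots> \<le> K * C" using \<phi>(2) KC_nonneg by (simp add: mult_left_le)
  finally show ?thesis .
qed

lemma finite_rank_ordbdd:
  fixes f :: "nat \<Rightarrow> 'y \<Rightarrow>\<^sub>L real"
  assumes T: "\<And>y. T y = (\<Sum>j<n. f j y *\<^sub>R xs j)"
  shows "ordbdd_L J T" "mnorm_L J T \<le> K * C"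
proof -
  define E where "E = (\<Sum>j<n. labs (J (xs j)))"
  note J_linear = bounded_linear.linear[OF J]
  have ex: "\<exists>z. ordbdd_L_by J T z \<and> norm z \<le> K * C + \<epsilon> * norm E" if "0 < \<epsilon>" for \<epsilon>
  proof -
    obtain F where F: "finite F" "F \<subseteq> cball 0 1"
      "\<And>y. norm y \<le> 1 \<Longrightarrow> \<exists>y'\<in>F. \<forall>j<n. \<bar>f j y - f j y'\<bar> \<le> \<epsilon>"
      using finite_net_of_functionals[OF \<open>0 < \<epsilon>\<close>, of n f] by blast
    obtain w where w: "w \<in> decomposable J T" "\<forall>y\<in>insert 0 F. J (T y) \<le> w"
      using decomposable_upper_bound[of "insert 0 F" J T] F(1,2) by auto
    have "0 \<le> w" using w(2) by (simp add: blinfun.zero_right linear_0[OF J_linear])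
    have "J (T y) \<le> w + \<epsilon> *\<^sub>R E" if "norm y \<le> 1" for y
    proof -
      obtain y' where y': "y' \<in> F" "\<And>j. j < n \<Longrightarrow> \<bar>f j y - f j y'\<bar> \<le> \<epsilon>" using F(3)[OF \<open>norm y \<le> 1\<close>] by blast
      have "J (T y) = J (T y') + (\<Sum>j<n. (f j y - f j y') *\<^sub>R J (xs j))"
        by (simp add: T linear_sum[OF J_linear] linear_cmul[OF J_linear] algebra_simps flip: sum.distrib)
      also have "\<dots> \<le> w + (\<Sum>j<n. \<epsilon> *\<^sub>R labs (J (xs j)))"
      proof (intro add_mono sum_mono)
        show "J (T y') \<le> w" using w(2) y'(1) by simp
        fix j assume "j \<in> {..<n}"
        then have "\<bar>f j y - f j y'\<bar> *\<^sub>R labs (J (xs j)) \<le> \<epsilon> *\<^sub>R labs (J (xs j))"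
          by (intro scaleR_right_mono y' labs_nonneg) simp
        then show "(f j y - f j y') *\<^sub>R J (xs j) \<le> \<epsilon> *\<^sub>R labs (J (xs j))"
          using scaleR_le_labs order.trans by blast
      qed
      finally show ?thesis by (simp add: E_def scaleR_right.sum)
    qed
    then have "ordbdd_L_by J T (w + \<epsilon> *\<^sub>R E)" by (rule ordbdd_L_byI[OF J])
    moreover have "norm (w + \<epsilon> *\<^sub>R E) \<le> K * C + \<epsilon> * norm E"
      using norm_triangle_ineq[of w "\<epsilon> *\<^sub>R E"] norm_decomposable_le[OF w(1) \<open>0 \<le> w\<close>] \<open>0 < \<epsilon>\<close> by simp
    ultimately show ?thesis by blast
  qed
  show "ordbdd_L J T" using ex[of 1] by (auto simp: ordbdd_L_def)
  have le: "mnorm_L J T \<le> K * C + \<epsilon> * norm E" if \<epsilon>: "0 < \<epsilon>" for \<epsilon>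
  proof -
    obtain z where z: "ordbdd_L_by J T z" "norm z \<le> K * C + \<epsilon> * norm E" using ex[OF \<epsilon>] by blast
    have "mnorm_L J T \<le> norm z"
      unfolding mnorm_L_def using z(1) by (intro cInf_lower bdd_belowI[of _ 0]) auto
    with z(2) show ?thesis by simp
  qed
  show "mnorm_L J T \<le> K * C"
  proof (rule field_le_epsilon)
    fix \<eta> :: real assume "0 < \<eta>"
    define \<epsilon> where "\<epsilon> = \<eta> / (norm E + 1)"
    have "0 < \<epsilon>" using \<open>0 < \<eta>\<close> by (simp add: \<epsilon>_def add_nonneg_pos)
    have "\<epsilon> * norm E \<le> \<epsilon> * (norm E + 1)" using \<open>0 < \<epsilon>\<close> by simp
    also have "\<dots> = \<eta>" using add_nonneg_pos[of "norm E" 1] by (simp add: \<epsilon>_def)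
    finally show "mnorm_L J T \<le> K * C + \<eta>" using le[OF \<open>0 < \<epsilon>\<close>] by simp
  qed
qed

lemma psumming_ordbdd:
  shows "ordbdd_bidual J T" "mnorm_bidual J T \<le> K * C"
proof -
  note J_linear = bounded_linear.linear[OF J]
  let ?q = "\<lambda>\<phi> :: 'l \<Rightarrow>\<^sub>L real. K * C * norm \<phi>"
  have "sublinear ?q"
    unfolding sublinear_def
  proof (intro conjI allI impI)
    show "K * C * norm (\<phi> + \<psi>) \<le> K * C * norm \<phi> + K * C * norm \<psi>" for \<phi> \<psi> :: "'l \<Rightarrow>\<^sub>L real"
      unfolding distrib_left[symmetric] by (intro mult_left_mono norm_triangle_ineq KC_nonneg)
  qed simp
  then obtain f where f: "linear f" "\<And>\<phi>. f \<phi> \<le> ?q \<phi>"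
    "\<And>\<phi> r. (\<phi>, r) \<in> decomposition_cone J T \<Longrightarrow> r \<le> f \<phi>"
    using hahn_banach_cone[OF _ minorant_cone_decomposition[OF decomposition_cone_bound]] by metis
  have abs_f: "\<bar>f \<phi>\<bar> \<le> ?q \<phi>" for \<phi>
    using f(2)[of \<phi>] f(2)[of "- \<phi>"] by (simp add: linear_neg[OF f(1)])
  have bl: "bounded_linear f"
    using f(1) abs_f by (intro bounded_linear_intro[of _ "K * C"]) (auto simp: linear_add linear_cmul mult.commute)
  define z where "z = Blinfun f"
  have z: "z \<phi> = f \<phi>" for \<phi> by (simp add: z_def bounded_linear_Blinfun_apply[OF bl])
  have norm_z: "norm z \<le> K * C" using abs_f KC_nonneg by (intro norm_blinfun_bound) (auto simp: z)
  have unit: "\<phi> (J (T y)) \<le> z \<phi>" if "pos_dual \<phi>" "norm y \<le> 1" for \<phi> y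
    unfolding z by (intro f(3) decomposition_cone_single that)
  have le: "\<phi> (J (T y)) \<le> norm y * z \<phi>" if \<phi>: "pos_dual \<phi>" for \<phi> y
  proof (cases "y = 0")
    case False
    have "norm y * \<phi> (J (T ((1 / norm y) *\<^sub>R y))) \<le> norm y * z \<phi>"
      using False by (intro mult_left_mono unit \<phi>) auto
    then show ?thesis
      using False by (simp add: blinfun.scaleR_right linear_cmul[OF J_linear])
  qed (simp add: blinfun.zero_right linear_0[OF J_linear])
  have bdd: "ordbdd_bidual_by J T z"
    unfolding ordbdd_bidual_by_def abs_le_bidual_def le_bidual_def
  proof (intro conjI allI impI)
    fix \<phi> :: "'l \<Rightarrow>\<^sub>L real" assume \<phi>: "pos_dual \<phi>"
    show "blinfun_apply 0 \<phi> \<le> z \<phi>"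
      using unit[OF \<phi>, of 0] by (simp add: blinfun.zero_right linear_0[OF J_linear])
    fix y
    show "bidual_emb (J (T y)) \<phi> \<le> (norm y *\<^sub>R z) \<phi>"
      using le[OF \<phi>, of y] by (simp add: bidual_emb_apply blinfun.scaleR_left)
    show "(- bidual_emb (J (T y))) \<phi> \<le> (norm y *\<^sub>R z) \<phi>"
      using le[OF \<phi>, of "- y"]
      by (simp add: bidual_emb_apply blinfun.scaleR_left blinfun.minus_left blinfun.minus_right linear_neg[OF J_linear])
  qed
  then show "ordbdd_bidual J T" by (auto simp: ordbdd_bidual_def)
  have "mnorm_bidual J T \<le> norm z"
    unfolding mnorm_bidual_def using bdd by (intro cInf_lower bdd_belowI[of _ 0]) auto
  with norm_z show "mnorm_bidual J T \<le> K * C" by simp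
qed

end

lemma le_Inf_mult_Inf:
  fixes A B :: "real set"
  assumes "A \<noteq> {}" "B \<noteq> {}" and pos: "\<And>a. a \<in> A \<Longrightarrow> 0 < a" "\<And>b. b \<in> B \<Longrightarrow> 0 \<le> b"
    and le: "\<And>a b. a \<in> A \<Longrightarrow> b \<in> B \<Longrightarrow> m \<le> a * b"
  shows "m \<le> Inf A * Inf B"
proof -
  have le_Inf: "m \<le> a * Inf B" if "a \<in> A" for a
  proof -
    have "m / a \<le> Inf B"
      using le[OF that] pos(1)[OF that] \<open>B \<noteq> {}\<close> by (intro cInf_greatest) (auto simp: divide_le_eq mult.commute)
    then show ?thesis using pos(1)[OF that] by (simp add: divide_le_eq mult.commute)
  qed
  have "0 \<le> Inf B" using pos(2) \<open>B \<noteq> {}\<close> by (intro cInf_greatest) auto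
  show ?thesis
  proof (cases "Inf B = 0")
    case True
    then show ?thesis using le_Inf \<open>A \<noteq> {}\<close> by auto
  next
    case False
    with \<open>0 \<le> Inf B\<close> have "0 < Inf B" by simp
    then have "m / Inf B \<le> Inf A"
      using le_Inf \<open>A \<noteq> {}\<close> by (intro cInf_greatest) (auto simp: divide_le_eq)
    then show ?thesis using \<open>0 < Inf B\<close> by (simp add: divide_le_eq)
  qed
qed

lemma le_Kp_mult_pi_p:
  assumes "pconvex p J" "psumming_const p S C0"
    and "\<And>K C. pconvex_const p J K \<Longrightarrow> psumming_const p S C \<Longrightarrow> m \<le> K * C"
  shows "m \<le> Kp p J * pi_p p S"
  unfolding Kp_def pi_p_def
proof (rule le_Inf_mult_Inf)
  show "0 < K" if "K \<in> {K. pconvex_const p J K}" for K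
    using that by (auto simp: pconvex_const_def)
qed (use assms in \<open>auto simp: pconvex_def psumming_const_def\<close>)

theorem theorem0p3:
  fixes p :: real
    and J :: "'x::banach \<Rightarrow> 'l::banach_lattice"
    and T :: "'y::banach \<Rightarrow>\<^sub>L 'x"
  assumes p: "1 \<le> p"
    and J_lin: "bounded_linear J"
    and J_isom: "\<And>x. norm (J x) = norm x"
    and X_pconv: "pconvex p J"
  shows "((\<exists>n (ys :: nat \<Rightarrow> ('y \<Rightarrow>\<^sub>L real)) (xs :: nat \<Rightarrow> 'x).
            \<forall>y. T y = (\<Sum>j<n. ys j y *\<^sub>R xs j))
         \<longrightarrow> ordbdd_L J T \<and> mnorm_L J T \<le> Kp p J * pi_p p (dual_op T))
       \<and> (psumming p (dual_op T)
         \<longrightarrow> ordbdd_bidual J T \<and> mnorm_bidual J T \<le> Kp p J * pi_p p (dual_op T))"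
proof (intro conjI impI)
  obtain K0 where K0: "pconvex_const p J K0" using X_pconv by (auto simp: pconvex_def)
  {
    assume "\<exists>n (ys :: nat \<Rightarrow> ('y \<Rightarrow>\<^sub>L real)) (xs :: nat \<Rightarrow> 'x). \<forall>y. T y = (\<Sum>j<n. ys j y *\<^sub>R xs j)"
    then obtain n and ys :: "nat \<Rightarrow> ('y \<Rightarrow>\<^sub>L real)" and xs :: "nat \<Rightarrow> 'x"
      where T: "\<And>y. T y = (\<Sum>j<n. ys j y *\<^sub>R xs j)" by blast
    note C0 = psumming_const_finite_rank[OF p T]
    show "ordbdd_L J T" by (rule finite_rank_ordbdd[OF p J_lin K0 C0 T])
    show "mnorm_L J T \<le> Kp p J * pi_p p (dual_op T)"
      by (rule le_Kp_mult_pi_p[OF X_pconv C0 finite_rank_ordbdd(2)[OF p J_lin _ _ T]])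
  next
    assume "psumming p (dual_op T)"
    then obtain C0 where C0: "psumming_const p (dual_op T) C0" by (auto simp: psumming_def)
    show "ordbdd_bidual J T" by (rule psumming_ordbdd[OF p J_lin K0 C0])
    show "mnorm_bidual J T \<le> Kp p J * pi_p p (dual_op T)"
      by (rule le_Kp_mult_pi_p[OF X_pconv C0 psumming_ordbdd(2)[OF p J_lin]])
  }
qed

end
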